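(* There exists $C^\infty$ initial data $f_0(x,v)$, $f_0\in\mathcal{S}(\mathbb{R}^4)$, for the Vlasov-Poisson system on $\mathbb{R}^2\times\mathbb{R}^2$ $$\partial_tf(x,v,t)+v\cdot\nabla_xf(x,v,t)+E(x,t)\cdot\nabla_vf(x,v,t)=0,\qquad f|_{t=0}=f_0,$$ $$E=-\nabla_x\phi,\qquad-\Delta_x\phi=\rho,\qquad\rho(x,t)=\int_{\mathbb{R}^2} f(x,w,t)\,dw,$$ with a global $C^\infty$ solution $f(x,v,t)$ which has the following property. For the phase-space trajectory map $(X(\zeta,t),V(\zeta,t))$ solving $$\dot X=V,\qquad\dot V=E(X,t),\qquad(X(\zeta,0),V(\zeta,0))=\zeta\in\mathbb{R}^2\times\mathbb{R}^2,$$ with $E(x,t)=\int\int K(x-y)f(y,\xi,t)\,dy\,d\xi$, there is some trajectory $(X(\zeta_0,t),V(\zeta_0,t))$ which is not analytic in time at $t=0$.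
   Context: $K(x)=\frac{1}{2\pi}\frac{x}{|x|^2}$ for $x\in\mathbb{R}^2\setminus\{0\}$, the integral kernel of $\nabla\Delta^{-1}$ on $\mathbb{R}^2$. $\mathcal{S}$ denotes the Schwartz space. The paper takes the repulsive sign convention as written here. *)

theory Defs
  imports "HOL-Analysis.Analysis"
begin

section \<open>Calculus on Euclidean spaces\<close>

definition partial_deriv ::
    "'a::euclidean_space \<Rightarrow> ('a \<Rightarrow> 'b::real_normed_vector) \<Rightarrow> 'a \<Rightarrow> 'b" where
  "partial_deriv b g x = vector_derivative (\<lambda>s. g (x + s *\<^sub>R b)) (at 0)"

fun iter_partial ::
    "'a::euclidean_space list \<Rightarrow> ('a \<Rightarrow> 'b::real_normed_vector) \<Rightarrow> 'a \<Rightarrow> 'b" where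
  "iter_partial [] g = g"
| "iter_partial (b # bs) g = partial_deriv b (iter_partial bs g)"

text \<open>
  \<open>C\<^sup>\<infinity>\<close> on the whole space: every iterated partial derivative is (Frechet) differentiable
  everywhere. In particular all of them exist and are continuous.
\<close>

definition smooth :: "('a::euclidean_space \<Rightarrow> 'b::real_normed_vector) \<Rightarrow> bool" where
  "smooth g \<longleftrightarrow> (\<forall>bs. set bs \<subseteq> Basis \<longrightarrow> iter_partial bs g differentiable_on UNIV)"

definition schwartz :: "('a::euclidean_space \<Rightarrow> 'b::real_normed_vector) \<Rightarrow> bool" where
  "schwartz g \<longleftrightarrow> smooth g \<and>
     (\<forall>bs k. set bs \<subseteq> Basis \<longrightarrow> (\<exists>C. \<forall>x. norm x ^ k * norm (iter_partial bs g x) \<le> C))"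

definition grad :: "('a::euclidean_space \<Rightarrow> real) \<Rightarrow> 'a \<Rightarrow> 'a" where
  "grad g x = (\<Sum>b\<in>Basis. partial_deriv b g x *\<^sub>R b)"

definition laplacian :: "('a::euclidean_space \<Rightarrow> real) \<Rightarrow> 'a \<Rightarrow> real" where
  "laplacian g x = (\<Sum>b\<in>Basis. partial_deriv b (partial_deriv b g) x)"

text \<open>
  Analyticity at \<open>t0\<close> relative to a time set \<open>S\<close>: near \<open>t0\<close>, a power series about \<open>t0\<close>
  converges to \<open>g\<close> at the points of \<open>S\<close>. For \<open>S = UNIV\<close> this is ordinary real analyticity
  at \<open>t0\<close>; for \<open>S = {t0..}\<close> it is analyticity up to the endpoint \<open>t0\<close>, which ordinary
  analyticity implies.
\<close>

definition analytic_within ::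
    "(real \<Rightarrow> 'a::real_normed_vector) \<Rightarrow> real \<Rightarrow> real set \<Rightarrow> bool" where
  "analytic_within g t0 S \<longleftrightarrow>
     (\<exists>r>0. \<exists>a. \<forall>t\<in>S. \<bar>t - t0\<bar> < r \<longrightarrow> (\<lambda>n. (t - t0) ^ n *\<^sub>R a n) sums g t)"

section \<open>The Vlasov-Poisson system on the plane\<close>

text \<open>The junk value at the origin is \<open>0\<close>; it does not affect the integrals.\<close>

definition K :: "real^2 \<Rightarrow> real^2" where
  "K x = (1 / (2 * pi)) *\<^sub>R ((1 / (norm x)\<^sup>2) *\<^sub>R x)"

definition charge_density :: "((real^2) \<times> (real^2) \<times> real \<Rightarrow> real) \<Rightarrow> real^2 \<Rightarrow> real \<Rightarrow> real" where
  "charge_density f x t = (\<integral>w. f (x, w, t) \<partial>lborel)"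

definition efield :: "((real^2) \<times> (real^2) \<times> real \<Rightarrow> real) \<Rightarrow> real^2 \<Rightarrow> real \<Rightarrow> real^2" where
  "efield f x t = (\<integral>(y, \<xi>). f (y, \<xi>, t) *\<^sub>R K (x - y) \<partial>lborel)"

text \<open>
  A Bochner integral of a non-integrable function is \<open>0\<close>, so the absolute convergence of the
  integrals defining \<open>charge_density f\<close> and \<open>efield f\<close> is part of being a solution. The potential
  is determined only up to a function of time; \<open>C\<^sup>\<infinity>\<close> smoothness of the solution
  includes that of a potential, hence of the field.
\<close>

definition vlasov_poisson_solution ::
    "((real^2) \<times> (real^2) \<Rightarrow> real) \<Rightarrow> ((real^2) \<times> (real^2) \<times> real \<Rightarrow> real) \<Rightarrow> bool" where
  "vlasov_poisson_solution f0 f \<longleftrightarrow>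
     smooth f \<and>
     (\<forall>x v. f (x, v, 0) = f0 (x, v)) \<and>
     (\<forall>x t. integrable lborel (\<lambda>w. f (x, w, t))) \<and>
     (\<forall>x t. integrable lborel (\<lambda>(y, \<xi>). f (y, \<xi>, t) *\<^sub>R K (x - y))) \<and>
     (\<exists>\<phi> :: (real^2) \<times> real \<Rightarrow> real. smooth \<phi> \<and>
        (\<forall>x t. efield f x t = - grad (\<lambda>y. \<phi> (y, t)) x) \<and>
        (\<forall>x t. - laplacian (\<lambda>y. \<phi> (y, t)) x = charge_density f x t)) \<and>
     (\<forall>x v t. deriv (\<lambda>s. f (x, v, s)) t
        + v \<bullet> grad (\<lambda>y. f (y, v, t)) x
        + efield f x t \<bullet> grad (\<lambda>w. f (x, w, t)) v = 0)"

definition trajectory_map ::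
    "(real^2 \<Rightarrow> real \<Rightarrow> real^2) \<Rightarrow> ((real^2) \<times> (real^2) \<Rightarrow> real \<Rightarrow> real^2) \<Rightarrow>
     ((real^2) \<times> (real^2) \<Rightarrow> real \<Rightarrow> real^2) \<Rightarrow> bool" where
  "trajectory_map E X V \<longleftrightarrow>
     (\<forall>\<zeta>. (X \<zeta> 0, V \<zeta> 0) = \<zeta> \<and>
        (\<forall>t. (X \<zeta> has_vector_derivative V \<zeta> t) (at t) \<and>
             (V \<zeta> has_vector_derivative E (X \<zeta> t) t) (at t)))"

end

theory Submission
  imports Defs "HOL-Complex_Analysis.Complex_Analysis"
begin

text \<open>
  Take a stationary solution \<open>f = F(|v|\<^sup>2/2 + \<Phi>(|x|\<^sup>2))\<close>. In the plane the Poisson equation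
  for such an \<open>f\<close> reads \<open>4 (s \<Phi>'(s))' = - 2 \<pi> \<integral>\<^bsub>e \<ge> \<Phi>(s)\<^esub> F(e) de\<close> with \<open>s = |x|\<^sup>2\<close>, so after choosing
  \<open>\<Phi>\<close> increasing one simply reads off \<open>F\<close> as a derivative along \<open>\<Phi>\<^sup>-\<^sup>1\<close>; no sign of \<open>F\<close> is
  required. Choose \<open>\<Phi>' = 1/q\<close> with \<open>q(s) = s\<close> for \<open>s \<ge> 1\<close> and
  \<open>q(s) = s + (1 - s) exp(- 1/(1 - s))\<close> for \<open>s < 1\<close>. Outside the unit disc the potential is then
  logarithmic, hence confining, so \<open>f\<close> is smooth with compact support, while the field
  \<open>E = - 2 x / q(|x|\<^sup>2)\<close> is smooth but not analytic across the unit circle. A particle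
  entering the disc sees this: \<open>X \<bullet> V'\<close> differs from \<open>- 2\<close> by a nonzero function of time that
  is flat at the time of entry. That \<open>E\<close> is the convolution with \<open>K\<close> is Newton's theorem
  for radial charges, obtained from the geometric expansion of \<open>1/(z - w)\<close>, whose terms integrate
  to zero by rotation invariance.
\<close>

section \<open>Calculus of smooth functions\<close>

text \<open>Working in \<open>s = |x|^2\<close> keeps radial functions smooth at the origin, and
  planar Lebesgue measure becomes \<open>pi ds\<close> on \<open>s \<ge> 0\<close>. Hence the
  velocity integral of a function of the energy is an integral over energies with constant weight,
  and a single differentiation inverts it. The sign convention is repulsive, so a confining
  potential requires negative total charge: the charge inside radius \<open>sqrt s\<close> is
  \<open>- 4 pi s / q(s)\<close>, and \<open>F\<close> must take negative values. The profile
  \<open>q\<close> is kept positive on the whole line, including negative \<open>s\<close>, which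
  have no geometric meaning: the potential is then a smooth bijection of the reals and
  \<open>F\<close> is smooth at every energy, without cut-offs. \<open>F\<close> lives on energies
  at most that of a particle at rest on the unit circle, so the particles of \<open>f\<close> stay
  in the closed disc. The trajectory that fails to be analytic is that of a test particle of higher
  energy, where \<open>f\<close> vanishes; time zero is placed at the moment when it crosses the
  circle inwards, and forward times alone give the contradiction.\<close>

lemma partial_deriv_eq_frechet_derivative:
  assumes "(g has_derivative g') (at x)"
  shows "partial_deriv b g x = g' b"
proof -
  have 1: "((\<lambda>s::real. x + s *\<^sub>R b) has_derivative (\<lambda>s. s *\<^sub>R b)) (at 0)"
    by (auto intro!: derivative_eq_intros)
  have "((\<lambda>s::real. g (x + s *\<^sub>R b)) has_derivative (\<lambda>s. g' (s *\<^sub>R b))) (at 0)"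
    using has_derivative_compose[OF 1, of g g'] assms by simp
  moreover have "(\<lambda>s. g' (s *\<^sub>R b)) = (\<lambda>s. s *\<^sub>R g' b)"
    using has_derivative_linear[OF assms] by (simp add: linear_scale)
  ultimately have "((\<lambda>s::real. g (x + s *\<^sub>R b)) has_vector_derivative g' b) (at 0)"
    by (simp add: has_vector_derivative_def)
  then show ?thesis
    unfolding partial_deriv_def by (rule vector_derivative_at)
qed

lemma partial_deriv_real:
  fixes g :: "real \<Rightarrow> real"
  assumes "(g has_real_derivative d) (at x)"
  shows "partial_deriv 1 g x = d"
  using partial_deriv_eq_frechet_derivative[of g "(*) d" x 1] assms
  by (simp add: has_field_derivative_def)

text \<open>Replaces inductions over lists of directions: to prove smoothness it is enough to
  exhibit a class of differentiable functions that is closed under partial derivatives and contains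
  the given one. Each smoothness proof below amounts to finding such a class.\<close>

lemma smooth_coinduct:
  assumes "P g"
    and diff: "\<And>h x. P h \<Longrightarrow> h differentiable (at x)"
    and part: "\<And>h b. P h \<Longrightarrow> b \<in> Basis \<Longrightarrow> P (partial_deriv b h)"
  shows "smooth g"
proof -
  have "P (iter_partial bs g)" if "set bs \<subseteq> Basis" for bs
    using that by (induction bs) (auto intro: assms)
  then show ?thesis
    unfolding smooth_def differentiable_on_def
    using diff by (meson differentiable_at_withinI)
qed

lemma smooth_real_coinduct:
  fixes g :: "real \<Rightarrow> real"
  assumes "P g"
    and deriv: "\<And>h. P h \<Longrightarrow> \<exists>h'. P h' \<and> (\<forall>x. (h has_real_derivative h' x) (at x))"
  shows "smooth g"
proof (rule smooth_coinduct[of P])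
  fix h :: "real \<Rightarrow> real" and x b :: real
  assume "P h"
  then obtain h' where h': "P h'" "\<forall>x. (h has_real_derivative h' x) (at x)"
    using deriv by blast
  then show "h differentiable (at x)"
    by (auto simp: real_differentiable_def)
  have "partial_deriv 1 h = h'"
    using h' partial_deriv_real by blast
  then show "P (partial_deriv b h)" if "b \<in> Basis"
    using that h' by simp
qed fact

lemma smooth_differentiable: "smooth g \<Longrightarrow> g differentiable (at x)"
  unfolding smooth_def differentiable_on_def
  by (metis UNIV_I empty_subsetI iter_partial.simps(1) list.set(1))

lemma smooth_partial_deriv:
  assumes "smooth g" "b \<in> Basis"
  shows "smooth (partial_deriv b g)"
proof -
  \<comment> \<open>The head of the list is the outermost derivative, so the one taken first goes to
    the end.\<close>
  have eq: "iter_partial bs (partial_deriv b g) = iter_partial (bs @ [b]) g" for bs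
    by (induction bs) auto
  show ?thesis
    using assms unfolding smooth_def eq by auto
qed

lemma smooth_iter_partial: "smooth g \<Longrightarrow> set bs \<subseteq> Basis \<Longrightarrow> smooth (iter_partial bs g)"
  by (induction bs) (auto intro: smooth_partial_deriv)

lemma smooth_continuous: "smooth g \<Longrightarrow> continuous_on UNIV g"
  by (meson continuous_at_imp_continuous_on differentiable_imp_continuous_within smooth_differentiable)

lemma smooth_has_real_derivative:
  fixes g :: "real \<Rightarrow> real"
  assumes "smooth g"
  shows "(g has_real_derivative partial_deriv 1 g x) (at x)"
proof -
  obtain d where "(g has_real_derivative d) (at x)"
    using smooth_differentiable[OF assms] real_differentiable_def by blast
  then show ?thesis
    using partial_deriv_real by metis
qed

text \<open>The chain and product rules produce sums of products of compositions, so no single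
  operation is closed under differentiation by itself. Putting all of them into one class lets a
  single coinduction yield all closure properties.\<close>

inductive smooth_algebra :: "('a::euclidean_space \<Rightarrow> real) \<Rightarrow> bool" where
  base: "smooth u \<Longrightarrow> smooth_algebra u"
| comp: "smooth (h :: real \<Rightarrow> real) \<Longrightarrow> smooth u \<Longrightarrow> smooth_algebra (\<lambda>x. h (u x))"
| add: "smooth_algebra u \<Longrightarrow> smooth_algebra w \<Longrightarrow> smooth_algebra (\<lambda>x. u x + w x)"
| mult: "smooth_algebra u \<Longrightarrow> smooth_algebra w \<Longrightarrow> smooth_algebra (\<lambda>x. u x * w x)"

lemma smooth_algebra_closed:
  assumes "smooth_algebra (u :: 'a::euclidean_space \<Rightarrow> real)"
  shows "(\<forall>x. u differentiable (at x)) \<and> (\<forall>b\<in>Basis. smooth_algebra (partial_deriv b u))"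
  using assms
proof induction
  case (base u)
  then show ?case
    by (auto intro: smooth_algebra.base smooth_partial_deriv smooth_differentiable)
next
  case (comp h u)
  let ?h' = "partial_deriv 1 h"
  have D: "((\<lambda>x. h (u x)) has_derivative (\<lambda>v. ?h' (u x) * frechet_derivative u (at x) v)) (at x)" for x
  proof -
    have "(u has_derivative frechet_derivative u (at x)) (at x)"
      using smooth_differentiable[OF comp(2)] frechet_derivative_works by blast
    moreover have "(h has_derivative (*) (?h' (u x))) (at (u x))"
      using smooth_has_real_derivative[OF comp(1)] by (simp add: has_field_derivative_def)
    ultimately show ?thesis
      using has_derivative_compose[of u _ x UNIV h] by blast
  qed
  have P: "partial_deriv b (\<lambda>x. h (u x)) = (\<lambda>x. ?h' (u x) * partial_deriv b u x)" for b
  proof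
    fix x
    have "partial_deriv b u x = frechet_derivative u (at x) b"
      using smooth_differentiable[OF comp(2), of x] frechet_derivative_works
        partial_deriv_eq_frechet_derivative by blast
    then show "partial_deriv b (\<lambda>x. h (u x)) x = ?h' (u x) * partial_deriv b u x"
      using partial_deriv_eq_frechet_derivative[OF D] by simp
  qed
  have "smooth_algebra (partial_deriv b (\<lambda>x. h (u x)))" if "b \<in> Basis" for b
    unfolding P using comp that
    by (intro smooth_algebra.mult smooth_algebra.comp smooth_algebra.base smooth_partial_deriv) auto
  then show ?case
    using D differentiable_def by blast
next
  case (add u w)
  have P: "partial_deriv b (\<lambda>x. u x + w x) = (\<lambda>x. partial_deriv b u x + partial_deriv b w x)" for b
  proof
    fix x
    obtain u' w' where *: "(u has_derivative u') (at x)" "(w has_derivative w') (at x)"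
      using add differentiable_def by metis
    show "partial_deriv b (\<lambda>x. u x + w x) x = partial_deriv b u x + partial_deriv b w x"
      using partial_deriv_eq_frechet_derivative[OF has_derivative_add[OF *]]
        *[THEN partial_deriv_eq_frechet_derivative] by simp
  qed
  show ?case
    unfolding P using add by (auto intro: smooth_algebra.add)
next
  case (mult u w)
  have P: "partial_deriv b (\<lambda>x. u x * w x)
      = (\<lambda>x. u x * partial_deriv b w x + partial_deriv b u x * w x)" for b
  proof
    fix x
    obtain u' w' where *: "(u has_derivative u') (at x)" "(w has_derivative w') (at x)"
      using mult differentiable_def by metis
    show "partial_deriv b (\<lambda>x. u x * w x) x = u x * partial_deriv b w x + partial_deriv b u x * w x"
      using partial_deriv_eq_frechet_derivative[OF has_derivative_mult[OF *]]
        *[THEN partial_deriv_eq_frechet_derivative] by simp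
  qed
  show ?case
    unfolding P using mult by (auto intro!: smooth_algebra.add intro: smooth_algebra.mult)
qed

lemma smooth_algebra_iff_smooth: "smooth_algebra u \<longleftrightarrow> smooth u"
  using smooth_coinduct[of smooth_algebra u] smooth_algebra_closed smooth_algebra.base by blast

lemma smooth_compose: "smooth h \<Longrightarrow> smooth u \<Longrightarrow> smooth (\<lambda>x. h (u x) :: real)"
  and smooth_add: "smooth u \<Longrightarrow> smooth w \<Longrightarrow> smooth (\<lambda>x. u x + w x :: real)"
  and smooth_mult: "smooth u \<Longrightarrow> smooth w \<Longrightarrow> smooth (\<lambda>x. u x * w x :: real)"
  for h :: "real \<Rightarrow> real" and u w :: "'a::euclidean_space \<Rightarrow> real"
  by (metis smooth_algebra_iff_smooth smooth_algebra.comp,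
      metis smooth_algebra_iff_smooth smooth_algebra.add,
      metis smooth_algebra_iff_smooth smooth_algebra.mult)

lemma smooth_const: "smooth (\<lambda>_::'a::euclidean_space. c::real)"
proof (rule smooth_coinduct[of "\<lambda>g. \<exists>c. g = (\<lambda>_. c)"])
  fix h :: "'a \<Rightarrow> real" and b assume "\<exists>c. h = (\<lambda>_. c)"
  then obtain c where h: "h = (\<lambda>_. c)" by blast
  then have "partial_deriv b h x = 0" for x
    using partial_deriv_eq_frechet_derivative[of h "\<lambda>_. 0"] by simp
  then show "\<exists>c. partial_deriv b h = (\<lambda>_. c)" by auto
qed auto

lemma smooth_bounded_linear:
  fixes l :: "'a::euclidean_space \<Rightarrow> real"
  assumes "bounded_linear l"
  shows "smooth l"
proof (rule smooth_coinduct[of "\<lambda>g. g = l \<or> smooth g"])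
  fix h :: "'a \<Rightarrow> real" and x b :: 'a
  assume h: "h = l \<or> smooth h"
  have D: "(l has_derivative l) (at x)" for x
    using assms by (rule bounded_linear_imp_has_derivative)
  show "h differentiable (at x)"
    using h D smooth_differentiable differentiable_def by blast
  have "partial_deriv b l = (\<lambda>_. l b)"
    using partial_deriv_eq_frechet_derivative[OF D] by auto
  then show "partial_deriv b h = l \<or> smooth (partial_deriv b h)" if "b \<in> Basis"
    using h smooth_const smooth_partial_deriv that by metis
qed simp

lemma smooth_sum:
  fixes u :: "'i \<Rightarrow> 'a::euclidean_space \<Rightarrow> real"
  assumes "\<And>i. i \<in> I \<Longrightarrow> smooth (u i)"
  shows "smooth (\<lambda>x. \<Sum>i\<in>I. u i x)"
  using assms by (induction I rule: infinite_finite_induct) (auto intro: smooth_const smooth_add)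

lemma smooth_norm_square:
  fixes l :: "'a::euclidean_space \<Rightarrow> 'b::euclidean_space"
  assumes "bounded_linear l"
  shows "smooth (\<lambda>x. l x \<bullet> l x)"
proof -
  have "smooth (\<lambda>x. \<Sum>b\<in>Basis. (l x \<bullet> b) * (l x \<bullet> b))"
    by (intro smooth_sum smooth_mult smooth_bounded_linear
        bounded_linear_compose[OF bounded_linear_inner_left] assms)
  then show ?thesis
    by (simp add: euclidean_inner[symmetric])
qed

lemma smooth_realI:
  fixes h :: "real \<Rightarrow> real"
  assumes "smooth h'" "\<And>x. (h has_real_derivative h' x) (at x)"
  shows "smooth h"
proof (rule smooth_real_coinduct[of "\<lambda>g. g = h \<or> smooth g"])
  fix g assume "g = h \<or> smooth g"
  then show "\<exists>g'. (g' = h \<or> smooth g') \<and> (\<forall>x. (g has_real_derivative g' x) (at x))"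
    using assms smooth_has_real_derivative smooth_partial_deriv[of g 1] by auto
qed simp

text \<open>The closed class consists of the quotients \<open>k / h^n\<close> with \<open>k\<close>
  smooth: the derivative is \<open>(k' h - n k h') / h^(n+1)\<close>.\<close>

lemma smooth_inverse:
  fixes h :: "real \<Rightarrow> real"
  assumes h: "smooth h" and nz: "\<And>x. h x \<noteq> 0"
  shows "smooth (\<lambda>x. inverse (h x))"
proof (rule smooth_real_coinduct[of "\<lambda>g. \<exists>k n. smooth k \<and> g = (\<lambda>x. k x * inverse (h x) ^ n)"])
  show "\<exists>k n. smooth k \<and> (\<lambda>x. inverse (h x)) = (\<lambda>x. k x * inverse (h x) ^ n)"
    by (intro exI[of _ "\<lambda>_. 1"] exI[of _ 1]) (simp add: smooth_const)
next
  fix g assume "\<exists>k n. smooth k \<and> g = (\<lambda>x. k x * inverse (h x) ^ n)"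
  then obtain k n where k: "smooth k" and g: "g = (\<lambda>x. k x * inverse (h x) ^ n)" by blast
  define k' where "k' x = partial_deriv 1 k x * h x + k x * (- real n * partial_deriv 1 h x)" for x
  have "smooth k'"
    unfolding k'_def using k h
    by (intro smooth_add smooth_mult smooth_const smooth_partial_deriv) auto
  moreover have "(g has_real_derivative k' x * inverse (h x) ^ Suc n) (at x)" for x
  proof -
    have "((\<lambda>x. inverse (h x) ^ n) has_real_derivative
        real n * (- partial_deriv 1 h x * inverse (h x) ^ 2) * inverse (h x) ^ (n - 1)) (at x)"
      by (rule derivative_eq_intros smooth_has_real_derivative[OF h] nz refl)+ (simp add: power2_eq_square)
    from DERIV_mult[OF smooth_has_real_derivative[OF k] this]
    show ?thesis
      unfolding g k'_def using nz[of x]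
      by (cases n) (simp_all add: field_simps power2_eq_square)
  qed
  ultimately show "\<exists>h'. (\<exists>k n. smooth k \<and> h' = (\<lambda>x. k x * inverse (h x) ^ n)) \<and> (\<forall>x. (g has_real_derivative h' x) (at x))"
    by blast
qed

section \<open>Compactly supported smooth functions are Schwartz functions\<close>

lemma iter_partial_zero_outside:
  fixes g :: "'a::euclidean_space \<Rightarrow> 'b::real_normed_vector"
  assumes "open U" "\<And>x. x \<in> U \<Longrightarrow> g x = 0" "x \<in> U"
  shows "iter_partial bs g x = 0"
  using assms(3)
proof (induction bs arbitrary: x)
  case (Cons b bs)
  have "(iter_partial bs g has_derivative (\<lambda>_. 0)) (at x)"
    using Cons assms(1) by (intro has_derivative_transform_within_open[OF has_derivative_const[of 0]]) auto
  then show ?case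
    using partial_deriv_eq_frechet_derivative by force
qed (use assms in auto)

lemma schwartz_if_compact_support:
  fixes g :: "'a::euclidean_space \<Rightarrow> 'b::real_normed_vector"
  assumes g: "smooth g" and supp: "\<And>x. norm x > R \<Longrightarrow> g x = 0"
  shows "schwartz g"
  unfolding schwartz_def
proof (intro conjI allI impI)
  fix bs :: "'a list" and k :: nat
  assume bs: "set bs \<subseteq> Basis"
  let ?h = "\<lambda>x. norm x ^ k * norm (iter_partial bs g x)"
  have "continuous_on (cball 0 R) ?h"
    using smooth_continuous[OF smooth_iter_partial[OF g bs]]
    by (intro continuous_intros) (auto intro: continuous_on_subset)
  then have "bounded (?h ` cball 0 R)"
    by (intro compact_imp_bounded compact_continuous_image) auto
  then obtain C where C: "\<And>x. x \<in> cball 0 R \<Longrightarrow> \<bar>?h x\<bar> \<le> C"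
    unfolding bounded_iff by fastforce
  have "?h x \<le> max C 0" for x
  proof (cases "norm x \<le> R")
    case True
    then show ?thesis using C[of x] by (auto simp: abs_le_iff)
  next
    case False
    have "open {x::'a. norm x > R}"
      by (intro open_Collect_less continuous_intros)
    then show ?thesis
      using iter_partial_zero_outside[of "{x. norm x > R}" g x bs] supp False by auto
  qed
  then show "\<exists>C. \<forall>x. ?h x \<le> C" by blast
qed fact

section \<open>The radial profile and the energy distribution\<close>

text \<open>The function of interest is \<open>flat 1\<close>, that is \<open>exp (- 1/u)\<close>
  extended by zero. The polynomial factor in \<open>1/u\<close> is there because derivatives of
  \<open>flat 1\<close> acquire one, and with it the family is closed under differentiation.\<close>

definition flat :: "real poly \<Rightarrow> real \<Rightarrow> real" where
  "flat p u = (if u > 0 then poly p (inverse u) * exp (- inverse u) else 0)"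

lemma flat_tendsto_0: "(flat p \<longlongrightarrow> 0) (at 0)"
proof -
  have "((\<lambda>w::real. \<Sum>i\<le>degree p. coeff p i * (w ^ i / exp w)) \<longlongrightarrow> 0) at_top"
    by (rule tendsto_eq_intros tendsto_power_div_exp_0 refl)+ simp
  then have "((\<lambda>w. poly p w * exp (- w)) \<longlongrightarrow> 0) at_top"
    by (simp add: poly_altdef exp_minus sum_divide_distrib field_simps)
  then have "((\<lambda>u. poly p (inverse u) * exp (- inverse u)) \<longlongrightarrow> 0) (at_right 0)"
    using filterlim_compose filterlim_inverse_at_top_right by blast
  then have "(flat p \<longlongrightarrow> 0) (at_right 0)"
    by (rule Lim_transform_eventually) (auto simp: flat_def eventually_at_filter)
  moreover have "(flat p \<longlongrightarrow> 0) (at_left 0)"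
    by (rule Lim_transform_eventually[OF tendsto_const]) (auto simp: flat_def eventually_at_filter)
  ultimately show ?thesis
    by (simp add: filterlim_split_at)
qed

text \<open>With \<open>w = 1/u\<close> one has \<open>d/du = - w^2 d/dw\<close>, which sends
  \<open>p(w) exp(-w)\<close> to \<open>w^2 (p - p')(w) exp(-w)\<close>; \<open>[:0, 0, 1:]\<close>
  is the factor \<open>w^2\<close>.\<close>

lemma flat_has_real_derivative:
  "(flat p has_real_derivative flat ((p - pderiv p) * [:0, 0, 1:]) u) (at u)"
proof (cases u "0 :: real" rule: linorder_cases)
  case less
  have "(flat p has_real_derivative 0) (at u)"
    by (rule has_field_derivative_transform_within_open[where f = "\<lambda>_. 0" and S = "{..<0}"])
      (use less in \<open>auto simp: flat_def\<close>)
  then show ?thesis using less by (simp add: flat_def)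
next
  case equal
  \<comment> \<open>Dividing by \<open>h\<close> multiplies the polynomial by its variable, so the
    difference quotient at \<open>0\<close> is again a flat function.\<close>
  have "((\<lambda>h. flat (pCons 0 p) h) \<longlongrightarrow> 0) (at 0)"
    by (rule flat_tendsto_0)
  then have "((\<lambda>h. (flat p h - flat p 0) / (h - 0)) \<longlongrightarrow> 0) (at 0)"
    by (rule Lim_transform_eventually) (auto simp: flat_def eventually_at_filter field_simps)
  then show ?thesis
    using equal by (simp add: has_field_derivative_iff flat_def)
next
  case greater
  have "((\<lambda>u. poly p (inverse u) * exp (- inverse u)) has_real_derivative
      flat ((p - pderiv p) * [:0, 0, 1:]) u) (at u)"
    using greater
    by (auto intro!: derivative_eq_intros simp: flat_def algebra_simps power2_eq_square)
  then show ?thesis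
    by (rule has_field_derivative_transform_within_open[where S = "{0<..}"])
      (use greater in \<open>auto simp: flat_def\<close>)
qed

lemma smooth_flat: "smooth (flat p)"
  by (rule smooth_real_coinduct[of "\<lambda>g. \<exists>p. g = flat p"]) (use flat_has_real_derivative in blast)+

text \<open>The factor \<open>1 - s\<close> in front of the flat term secures positivity for all
  \<open>s < 1\<close>: with \<open>a = 1/(1 - s)\<close> the inequality
  \<open>profile s > 0\<close> becomes \<open>exp (- a) > 1 - a\<close>.\<close>

definition profile :: "real \<Rightarrow> real" where
  "profile s = s + (1 - s) * flat 1 (1 - s)"

lemma profile_ge_1: "s \<ge> 1 \<Longrightarrow> profile s = s"
  by (simp add: profile_def flat_def)

lemma profile_le_1: "s \<le> 1 \<Longrightarrow> profile s \<le> 1"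
  by (cases "s = 1") (auto simp: profile_def flat_def intro: mult_left_le[of _ "1-s", THEN add_left_mono[of _ _ s], simplified])

lemma profile_pos: "profile s > 0"
proof (cases "s < 1")
  case True
  then have "1 - inverse (1 - s) < exp (- inverse (1 - s))"
    using exp_minus_greater[of "inverse (1 - s)"] by simp
  then have "(1 - s) * (1 - inverse (1 - s)) < (1 - s) * exp (- inverse (1 - s))"
    using True by (intro mult_strict_left_mono) auto
  moreover have "(1 - s) * (1 - inverse (1 - s)) = - s"
    using True by (simp add: right_diff_distrib)
  ultimately show ?thesis
    using True by (simp add: profile_def flat_def)
qed (simp add: profile_ge_1)

lemma smooth_minus_from_1: "smooth (\<lambda>s::real. 1 - s)"
  by (rule smooth_realI[of "\<lambda>_. -1"]) (auto intro!: derivative_eq_intros smooth_const)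

lemma smooth_id: "smooth (\<lambda>s::real. s)"
  by (intro smooth_bounded_linear bounded_linear_ident)

lemma smooth_profile: "smooth profile"
  unfolding profile_def[abs_def]
  by (intro smooth_add smooth_mult smooth_id smooth_minus_from_1 smooth_compose[OF smooth_flat])

definition profile' :: "real \<Rightarrow> real" where
  "profile' = partial_deriv 1 profile"

lemma profile_has_real_derivative [derivative_intros]:
  "(f has_real_derivative d) (at x within A) \<Longrightarrow>
    ((\<lambda>x. profile (f x)) has_real_derivative profile' (f x) * d) (at x within A)"
  unfolding profile'_def using DERIV_chain2 smooth_has_real_derivative[OF smooth_profile] by blast

lemma smooth_profile': "smooth profile'"
  unfolding profile'_def using smooth_partial_deriv[OF smooth_profile] by simp

lemma continuous_on_profile [continuous_intros]:
  "continuous_on A f \<Longrightarrow> continuous_on A (\<lambda>x. profile (f x))"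
  "continuous_on A f \<Longrightarrow> continuous_on A (\<lambda>x. profile' (f x))"
  using smooth_continuous[OF smooth_profile] smooth_continuous[OF smooth_profile']
  by (auto intro: continuous_on_compose2)

lemma profile'_gt_1: "s > 1 \<Longrightarrow> profile' s = 1"
proof -
  assume s: "s > 1"
  have "((\<lambda>s. s) has_real_derivative profile' s * 1) (at s)"
    by (rule has_field_derivative_transform_within_open[where f = profile and S = "{1<..}"],
        rule profile_has_real_derivative[OF DERIV_ident])
      (use s in \<open>auto simp: profile_ge_1\<close>)
  then show ?thesis
    using DERIV_unique[OF DERIV_ident] by force
qed

lemma smooth_inverse_profile: "smooth (\<lambda>s. inverse (profile s))"
  using profile_pos by (intro smooth_inverse smooth_profile) (metis less_irrefl)

section \<open>The potential as a function of the squared radius, and its inverse\<close>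

definition pot :: "real \<Rightarrow> real" where
  "pot = (SOME P. \<forall>s. (P has_real_derivative inverse (profile s)) (at s))"

text \<open>The additive constant of the antiderivative is left to the choice operator; the field
  and the charge do not depend on it, and the energy scale of \<open>energy_dist\<close> shifts
  along with it.\<close>

lemma pot_deriv: "(pot has_real_derivative inverse (profile s)) (at s)"
proof -
  have "\<exists>P. \<forall>s. - \<infinity> < ereal s \<longrightarrow> ereal s < \<infinity> \<longrightarrow>
      (P has_vector_derivative inverse (profile s)) (at s)"
    using smooth_continuous[OF smooth_inverse_profile]
    by (intro einterval_antiderivative) (auto simp: continuous_on_eq_continuous_at)
  then have "\<exists>P. \<forall>s. (P has_real_derivative inverse (profile s)) (at s)"
    by (simp add: has_real_derivative_iff_has_vector_derivative)
  from someI_ex[OF this] show ?thesis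
    unfolding pot_def by blast
qed

lemma pot_strict_mono: "strict_mono pot"
  by (rule strict_monoI, rule DERIV_pos_imp_increasing)
    (use pot_deriv profile_pos in \<open>auto intro!: exI\<close>)

lemma smooth_pot: "smooth pot"
  using smooth_inverse_profile pot_deriv by (rule smooth_realI)

lemma isCont_pot: "isCont pot s"
  using DERIV_isCont pot_deriv by blast

text \<open>Unbounded on both sides: for \<open>s \<ge> 1\<close> the profile is \<open>s\<close>
  and the potential grows like a logarithm; for \<open>s \<le> 1\<close> the profile is at most
  \<open>1\<close>, so the slope is at least \<open>1\<close>.\<close>

lemma surj_pot: "surj pot"
proof -
  have "\<exists>s. pot s = e" for e
  proof -
    have upper: "pot s = pot 1 + ln s" if "s \<ge> 1" for s
    proof -
      have "pot s - ln s = pot 1 - ln 1"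
      proof (rule DERIV_isconst2[of 1 "s+1"])
        show "((\<lambda>s. pot s - ln s) has_real_derivative 0) (at x)" if "1 < x" "x < s + 1" for x
          using that by (auto intro!: derivative_eq_intros pot_deriv simp: profile_ge_1 field_simps)
      qed (use that isCont_pot in \<open>auto intro!: continuous_intros continuous_at_imp_continuous_on\<close>)
      then show ?thesis by simp
    qed
    have lower: "pot s \<le> pot 1 + (s - 1)" if "s \<le> 1" for s
    proof -
      have "(\<lambda>s. pot s - s) s \<le> (\<lambda>s. pot s - s) 1"
      proof (rule DERIV_nonneg_imp_nondecreasing[OF that])
        fix x :: real assume "x \<le> 1"
        then have "inverse (profile x) \<ge> 1"
          using profile_le_1 profile_pos one_le_inverse by blast
        then show "\<exists>y. ((\<lambda>s. pot s - s) has_real_derivative y) (at x) \<and> 0 \<le> y"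
          by (intro exI[of _ "inverse (profile x) - 1"]) (auto intro!: derivative_eq_intros pot_deriv)
      qed
      then show ?thesis by simp
    qed
    \<comment> \<open>Solutions of \<open>pot 1 + (a - 1) = e\<close> and
      \<open>pot 1 + ln b = e\<close>, truncated to the ranges where the two estimates hold.\<close>
    define a b where "a = min 1 (1 + e - pot 1)" and "b = max 1 (exp (e - pot 1))"
    have "pot a \<le> e"
      using lower[of a] by (auto simp: a_def)
    moreover have "e \<le> pot b"
    proof -
      have "b \<ge> 1" "exp (e - pot 1) \<le> b"
        by (simp_all add: b_def)
      then have "e - pot 1 \<le> ln b"
        by (subst ln_ge_iff) auto
      then show ?thesis
        using upper[OF \<open>b \<ge> 1\<close>] by simp
    qed
    moreover have "a \<le> b"
      by (auto simp: a_def b_def)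
    ultimately show ?thesis
      using IVT'[of pot a e b] isCont_pot by (auto intro: continuous_at_imp_continuous_on)
  qed
  then show ?thesis by (metis surjI)
qed

definition pot_inv :: "real \<Rightarrow> real" where
  "pot_inv = inv pot"

lemma pot_inverse [simp]: "pot (pot_inv e) = e" "pot_inv (pot s) = s"
  unfolding pot_inv_def
  using surj_pot pot_strict_mono by (simp_all add: surj_f_inv_f strict_mono_imp_inj_on)

lemma pot_inv_deriv: "(pot_inv has_real_derivative profile (pot_inv e)) (at e)"
proof -
  have "isCont pot_inv e"
    using isCont_inverse_function[of 1 "pot_inv e" pot_inv pot] isCont_pot by simp
  then have "(pot_inv has_real_derivative inverse (inverse (profile (pot_inv e)))) (at e)"
    using profile_pos[of "pot_inv e"]
    by (intro DERIV_inverse_function[where f = pot and a = "e - 1" and b = "e + 1"] pot_deriv) auto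
  then show ?thesis by simp
qed

text \<open>Since the derivative of \<open>pot_inv\<close> is \<open>profile\<close> at
  \<open>pot_inv\<close>, differentiating \<open>k\<close> after \<open>pot_inv\<close> gives
  \<open>k' * profile\<close> after \<open>pot_inv\<close>, a function of the same form.\<close>

lemma smooth_compose_pot_inv:
  assumes "smooth k" shows "smooth (\<lambda>e. k (pot_inv e) :: real)"
proof (rule smooth_real_coinduct[of "\<lambda>g. \<exists>k. smooth k \<and> g = (\<lambda>e. k (pot_inv e))"])
  fix g assume "\<exists>k. smooth k \<and> g = (\<lambda>e. k (pot_inv e) :: real)"
  then obtain k where k: "smooth k" "g = (\<lambda>e. k (pot_inv e))" by blast
  have "smooth (\<lambda>s. partial_deriv 1 k s * profile s)"
    using k by (intro smooth_mult smooth_partial_deriv smooth_profile) auto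
  moreover have "(g has_real_derivative partial_deriv 1 k (pot_inv e) * profile (pot_inv e)) (at e)" for e
    using k DERIV_chain2[OF smooth_has_real_derivative pot_inv_deriv] by simp
  ultimately show "\<exists>h'. (\<exists>k. smooth k \<and> h' = (\<lambda>e. k (pot_inv e))) \<and> (\<forall>x. (g has_real_derivative h' x) (at x))"
    by (intro exI[of _ "\<lambda>e. partial_deriv 1 k (pot_inv e) * profile (pot_inv e)"]) auto
qed (use assms in blast)

text \<open>This is \<open>4 (s / profile s)'\<close>, the Laplacian of the potential and hence
  minus the charge density. It vanishes beyond the disc because the logarithm is harmonic in the
  plane.\<close>

definition neg_charge :: "real \<Rightarrow> real" where
  "neg_charge s = 4 * (profile s - s * profile' s) * inverse (profile s) * inverse (profile s)"

lemma smooth_neg_charge: "smooth neg_charge"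
proof -
  have "smooth (\<lambda>s. 4 * (profile s + (-1) * (s * profile' s)) * inverse (profile s) * inverse (profile s))"
    by (intro smooth_mult smooth_add smooth_const smooth_id smooth_profile smooth_profile' smooth_inverse_profile)
  then show ?thesis by (simp add: neg_charge_def[abs_def])
qed

lemma neg_charge_gt_1: "s > 1 \<Longrightarrow> neg_charge s = 0"
  by (simp add: neg_charge_def profile_ge_1 profile'_gt_1)

lemma enclosed_charge_deriv:
  "((\<lambda>s. 4 * s * inverse (profile s)) has_real_derivative neg_charge s) (at s)"
  using profile_pos[of s]
  by (auto intro!: derivative_eq_intros simp: neg_charge_def field_simps power2_eq_square)

text \<open>The derivative of \<open>neg_charge\<close> with respect to the energy, divided by
  \<open>2 * pi\<close>: the factor \<open>profile\<close> comes from the derivative of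
  \<open>pot_inv\<close>, and \<open>2 * pi\<close> from the velocity measure,
  \<open>pi d(|v|^2) = 2 pi d(|v|^2 / 2)\<close>.\<close>

definition energy_dist :: "real \<Rightarrow> real" where
  "energy_dist e = partial_deriv 1 neg_charge (pot_inv e) * profile (pot_inv e) * (1 / (2 * pi))"

lemma smooth_energy_dist: "smooth energy_dist"
  unfolding energy_dist_def[abs_def]
  using smooth_partial_deriv[OF smooth_neg_charge]
  by (intro smooth_compose_pot_inv[of "\<lambda>s. partial_deriv 1 neg_charge s * profile s * (1 / (2 * pi))"]
    smooth_mult smooth_profile smooth_const) auto

lemma neg_charge_pot_inv_deriv:
  "((\<lambda>e. neg_charge (pot_inv e)) has_real_derivative 2 * pi * energy_dist e) (at e)"
  using DERIV_chain2[OF smooth_has_real_derivative[OF smooth_neg_charge] pot_inv_deriv, of e]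
  by (simp add: energy_dist_def)

lemma energy_dist_zero:
  assumes "e > pot 1" shows "energy_dist e = 0"
proof -
  have s: "pot_inv e > 1"
    using assms pot_strict_mono by (metis pot_inverse(1) strict_mono_less)
  have "(neg_charge has_real_derivative 0) (at (pot_inv e))"
    by (rule has_field_derivative_transform_within_open[where f = "\<lambda>_. 0" and S = "{1<..}"])
      (use s in \<open>auto simp: neg_charge_gt_1\<close>)
  then show ?thesis
    by (simp add: energy_dist_def partial_deriv_real)
qed

section \<open>Rotation-invariant integrals in the plane\<close>

text \<open>Polar coordinates in the form used throughout: the disc of squared radius
  \<open>a\<close> has area \<open>pi * a\<close>, which is linear in \<open>a\<close>, so the
  push-forward has constant density. Half-lines suffice to compare the two measures.\<close>

lemma distr_lborel_inner_self:
  "distr (lborel :: (real^2) measure) borel (\<lambda>y. y \<bullet> y) =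
   density lborel (\<lambda>s. ennreal (pi * indicator {0..} s))" (is "?M = ?N")
proof (rule measure_eqI_generator_eq[where E = "range atMost" and \<Omega> = UNIV and A = "\<lambda>n. {..real n}"])
  show "Int_stable (range (atMost :: real \<Rightarrow> _))"
    by (auto simp: Int_stable_def)
  show sets: "sets ?M = sigma_sets UNIV (range atMost)" "sets ?N = sigma_sets UNIV (range atMost)"
    by (simp_all add: borel_eq_atMost)
  have M: "emeasure ?M {..a} = ennreal (pi * max a 0)" for a
  proof -
    have "emeasure ?M {..a} = emeasure lborel {y :: real^2. y \<bullet> y \<le> a}"
      by (subst emeasure_distr) (auto intro!: arg_cong[where f = "emeasure lborel"])
    also have "\<dots> = ennreal (pi * max a 0)"
    proof (cases "a \<ge> 0")
      case True
      have "{y :: real^2. y \<bullet> y \<le> a} = cball 0 (sqrt a)"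
        by (auto simp: norm_eq_sqrt_inner)
      then show ?thesis
        using True by (simp add: emeasure_cball unit_ball_vol_2)
    next
      case False
      then have "{y :: real^2. y \<bullet> y \<le> a} = {}"
        by (auto simp: not_le intro: less_le_trans)
      then show ?thesis using False by simp
    qed
    finally show ?thesis .
  qed
  have N: "emeasure ?N {..a} = ennreal (pi * max a 0)" for a
  proof -
    have "emeasure ?N {..a} = (\<integral>\<^sup>+s. ennreal pi * indicator {0..a} s \<partial>lborel)"
      by (subst emeasure_density) (auto intro!: nn_integral_cong split: split_indicator)
    also have "\<dots> = ennreal pi * emeasure lborel {0..a}"
      by (rule nn_integral_cmult_indicator) simp
    also have "\<dots> = ennreal (pi * max a 0)"
      by (cases "a \<ge> 0") (simp_all add: ennreal_mult')
    finally show ?thesis .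
  qed
  show "emeasure ?M X = emeasure ?N X" if "X \<in> range atMost" for X
    using that M N by auto
  show "emeasure ?M {..real i} \<noteq> \<infinity>" for i
    by (simp add: M)
  show "\<Union> (range (\<lambda>n. {..real n})) = UNIV"
    using real_arch_simple by auto
qed auto

lemma integrable_inner_self_iff:
  fixes h :: "real \<Rightarrow> 'b::{banach, second_countable_topology}"
  assumes [measurable]: "h \<in> borel_measurable borel"
  shows "integrable lborel (\<lambda>y::real^2. h (y \<bullet> y)) \<longleftrightarrow>
    integrable lborel (\<lambda>s. indicator {0..} s *\<^sub>R h s)"
proof -
  have "integrable lborel (\<lambda>y::real^2. h (y \<bullet> y)) \<longleftrightarrow>
      integrable (density lborel (\<lambda>s. ennreal (pi * indicator {0..} s))) h"
    unfolding distr_lborel_inner_self[symmetric] by (subst integrable_distr_eq) auto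
  also have "\<dots> \<longleftrightarrow> integrable lborel (\<lambda>s. pi *\<^sub>R indicator {0..} s *\<^sub>R h s)"
    by (subst integrable_density) auto
  also have "\<dots> \<longleftrightarrow> integrable lborel (\<lambda>s. indicator {0..} s *\<^sub>R h s)"
    (is "integrable lborel (\<lambda>s. pi *\<^sub>R ?h s) \<longleftrightarrow> _")
  proof
    assume "integrable lborel (\<lambda>s. pi *\<^sub>R ?h s)"
    then have "integrable lborel (\<lambda>s. inverse pi *\<^sub>R (pi *\<^sub>R ?h s))"
      by (rule integrable_scaleR_right)
    then show "integrable lborel ?h"
      by (simp add: mult.assoc[symmetric])
  qed (rule integrable_scaleR_right)
  finally show ?thesis .
qed

lemma integral_inner_self:
  fixes h :: "real \<Rightarrow> 'b::{banach, second_countable_topology}"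
  assumes [measurable]: "h \<in> borel_measurable borel"
  shows "(\<integral>y. h (y \<bullet> y) \<partial>(lborel :: (real^2) measure)) =
    pi *\<^sub>R (\<integral>s. indicator {0..} s *\<^sub>R h s \<partial>lborel)"
proof -
  have "(\<integral>y. h (y \<bullet> y) \<partial>(lborel :: (real^2) measure)) =
      (\<integral>s. h s \<partial>density lborel (\<lambda>s. ennreal (pi * indicator {0..} s)))"
    unfolding distr_lborel_inner_self[symmetric] by (subst integral_distr) auto
  also have "\<dots> = (\<integral>s. pi *\<^sub>R indicator {0..} s *\<^sub>R h s \<partial>lborel)"
    by (subst integral_density) auto
  finally show ?thesis
    by (simp del: scaleR_scaleR)
qed

lemma AE_inner_self_neq: "AE y in (lborel :: (real^2) measure). y \<bullet> y \<noteq> a"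
proof -
  have "AE s in density lborel (\<lambda>s. ennreal (pi * indicator {0..} s)). s \<noteq> a"
    using AE_lborel_singleton[of a] by (auto simp: AE_density elim!: eventually_mono)
  then show ?thesis
    unfolding distr_lborel_inner_self[symmetric] by (subst (asm) AE_distr_iff) auto
qed

lemma distr_lborel_orthogonal:
  fixes f :: "real^'n::{finite,wellorder} \<Rightarrow> real^'n::_"
  assumes f: "orthogonal_transformation f"
  shows "distr lborel borel f = lborel"
proof (rule lborel_eqI[symmetric])
  have lin: "linear f"
    using f orthogonal_transformation_linear by blast
  have [measurable]: "f \<in> borel_measurable borel"
    by (intro borel_measurable_continuous_onI linear_continuous_on linear_conv_bounded_linear[THEN iffD1] lin)
  fix l u :: "real^'n::_" assume lu: "\<And>b. b \<in> Basis \<Longrightarrow> l \<bullet> b \<le> u \<bullet> b"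
  have "f -` box l u = inv f ` box l u"
    using f orthogonal_transformation_bij bij_vimage_eq_inv_image by blast
  moreover have "inv f ` box l u \<in> lmeasurable"
    using f by (intro measurable_orthogonal_image orthogonal_transformation_inv) auto
  moreover have "measure lebesgue (inv f ` box l u) = measure lebesgue (box l u)"
    using f by (intro measure_orthogonal_image orthogonal_transformation_inv) auto
  ultimately have "emeasure lebesgue (f -` box l u) = ennreal (measure lebesgue (box l u))"
    by (metis emeasure_eq_measure2)
  moreover have "f -` box l u \<in> sets borel"
    using measurable_sets_borel[of f borel "box l u"] by simp
  ultimately have "emeasure lborel (f -` box l u) = ennreal (measure lborel (box l u))"
    by simp
  then have "emeasure (distr lborel borel f) (box l u) = ennreal (measure lborel (box l u))"
    by (simp add: emeasure_distr)
  then show "emeasure (distr lborel borel f) (box l u) = ennreal (prod ((\<bullet>) (u - l)) Basis)"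
    using lu by (simp add: measure_lborel_box_eq)
qed simp

section \<open>The plane as the complex numbers, and its rotations\<close>

definition plane_to_complex :: "real^2 \<Rightarrow> complex" where
  "plane_to_complex y = Complex (y $ 1) (y $ 2)"

definition complex_to_plane :: "complex \<Rightarrow> real^2" where
  "complex_to_plane w = vector [Re w, Im w]"

lemma plane_to_complex_simps [simp]:
  "plane_to_complex 0 = 0"
  "plane_to_complex (x - y) = plane_to_complex x - plane_to_complex y"
  "complex_to_plane (plane_to_complex y) = y"
  by (simp_all add: plane_to_complex_def complex_to_plane_def complex_eq_iff vec_eq_iff forall_2)

lemma norm_plane_to_complex: "norm (plane_to_complex y) = norm y"
  by (simp add: plane_to_complex_def cmod_def norm_vec_def L2_set_def sum_2)

lemma norm_complex_to_plane: "norm (complex_to_plane w) = norm w"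
  by (simp add: complex_to_plane_def cmod_def norm_vec_def L2_set_def sum_2)

lemma plane_to_complex_eq_0_iff [simp]: "plane_to_complex y = 0 \<longleftrightarrow> y = 0"
  using norm_plane_to_complex[of y] by (metis norm_eq_zero)

lemma bounded_linear_complex_to_plane: "bounded_linear complex_to_plane"
  by (rule bounded_linear_intro[of _ 1])
    (simp_all add: norm_complex_to_plane, simp_all add: complex_to_plane_def vec_eq_iff forall_2)

lemma borel_measurable_plane_to_complex [measurable]: "plane_to_complex \<in> borel_measurable borel"
  unfolding plane_to_complex_def[abs_def] Complex_eq
  by (intro borel_measurable_continuous_onI continuous_intros)

definition rotate :: "complex \<Rightarrow> real^2 \<Rightarrow> real^2" where
  "rotate w y = complex_to_plane (w * plane_to_complex y)"

lemma plane_to_complex_rotate [simp]: "plane_to_complex (rotate w y) = w * plane_to_complex y"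
  by (simp add: rotate_def plane_to_complex_def complex_to_plane_def complex_eq_iff)

lemma norm_rotate:
  assumes "norm w = 1" shows "norm (rotate w y) = norm y"
  using assms by (simp add: rotate_def norm_complex_to_plane norm_mult norm_plane_to_complex)

lemma orthogonal_transformation_rotate:
  assumes "norm w = 1" shows "orthogonal_transformation (rotate w)"
proof -
  have "linear (rotate w)"
    by (rule linearI)
      (simp_all add: rotate_def complex_to_plane_def plane_to_complex_def vec_eq_iff forall_2 algebra_simps)
  then show ?thesis
    using norm_rotate[OF assms] by (simp add: orthogonal_transformation)
qed

text \<open>The rotation by \<open>\<pi>/n\<close> changes the sign of the integrand.\<close>

lemma integral_radial_times_power_eq_0:
  fixes h :: "real \<Rightarrow> complex"
  assumes [measurable]: "h \<in> borel_measurable borel" and "n > 0"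
  shows "(\<integral>y. h (y \<bullet> y) * plane_to_complex y ^ n \<partial>lborel) = 0"
    and "(\<integral>y. h (y \<bullet> y) * inverse (plane_to_complex y ^ n) \<partial>lborel) = 0"
proof -
  define w where "w = cis (pi / n)"
  have w: "norm w = 1" "w ^ n = -1"
    using \<open>n > 0\<close> Complex.DeMoivre[of "pi / n" n] by (simp_all add: w_def)
  have inner: "rotate w y \<bullet> rotate w y = y \<bullet> y" for y
    using norm_rotate[OF w(1), of y] by (simp add: dot_square_norm)
  have D: "distr lborel borel (rotate w) = lborel"
    using distr_lborel_orthogonal orthogonal_transformation_rotate w by blast
  have [measurable]: "rotate w \<in> borel_measurable borel"
    using orthogonal_transformation_linear[OF orthogonal_transformation_rotate[OF w(1)]]
    by (intro borel_measurable_continuous_onI linear_continuous_on linear_conv_bounded_linear[THEN iffD1])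
  \<comment> \<open>Valid for every measurable \<open>k\<close>: if \<open>k\<close> is not
    integrable, both sides are \<open>0\<close>.\<close>
  have rot: "(\<integral>y. k y \<partial>lborel) = (\<integral>y. k (rotate w y) \<partial>lborel)"
    if [measurable]: "k \<in> borel_measurable borel" for k :: "real^2 \<Rightarrow> complex"
    by (subst D[symmetric], subst integral_distr) auto
  have zero: "z = 0" if "z = - z" for z :: complex
    using that by (simp add: complex_eq_iff)
  show "(\<integral>y. h (y \<bullet> y) * plane_to_complex y ^ n \<partial>lborel) = 0"
    by (rule zero, subst rot) (simp_all add: inner power_mult_distrib w)
  show "(\<integral>y. h (y \<bullet> y) * inverse (plane_to_complex y ^ n) \<partial>lborel) = 0"
    by (rule zero, subst rot) (simp_all add: inner power_mult_distrib w)
qed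

section \<open>Integrability of the singular kernel on bounded sets\<close>

lemma integrable_inverse_norm_ball:
  "integrable lborel (\<lambda>y::real^2. indicator (cball 0 R) y / norm y)"
proof (cases "R \<ge> 0")
  case True
  \<comment> \<open>In the variable \<open>s = |y|^2\<close> the function \<open>1/|y|\<close> is
    \<open>s powr (-1/2)\<close>, integrable at \<open>0\<close>.\<close>
  have "(\<lambda>s::real. s powr (-1/2)) integrable_on {0..R^2}"
    by (rule integrable_on_powr_from_0) auto
  then have "(\<lambda>s::real. s powr (-1/2)) absolutely_integrable_on {0..R^2}"
    by (rule nonnegative_absolutely_integrable_1) auto
  then have "integrable lebesgue (\<lambda>s::real. indicator {0..R^2} s *\<^sub>R s powr (-1/2))"
    by (simp only: set_integrable_def)
  then have "integrable lborel (\<lambda>s::real. indicator {0..R^2} s *\<^sub>R s powr (-1/2))"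
    by (rule integrable_completion[THEN iffD1, rotated]) measurable
  moreover have eq: "(\<lambda>s::real. indicator {0..R^2} s *\<^sub>R s powr (-1/2)) =
      (\<lambda>s. indicator {0..} s *\<^sub>R (indicator {..R^2} s / sqrt s))"
  proof
    fix s :: real
    show "indicator {0..R^2} s *\<^sub>R s powr (-1/2) = indicator {0..} s *\<^sub>R (indicator {..R^2} s / sqrt s)"
    proof (cases "s \<ge> 0")
      case True
      then have "s powr (-1/2) = 1 / sqrt s"
        by (metis divide_minus_left powr_half_sqrt powr_minus_divide)
      then show ?thesis
        using True by (simp only: indicator_def) auto
    qed (simp add: indicator_def)
  qed
  ultimately have "integrable lborel (\<lambda>s::real. indicator {0..} s *\<^sub>R (indicator {..R^2} s / sqrt s))"
    by (simp only: eq)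
  then have "integrable lborel (\<lambda>y::real^2. indicator {..R^2} (y \<bullet> y) / sqrt (y \<bullet> y))"
    by (rule integrable_inner_self_iff[THEN iffD2, rotated]) measurable
  moreover have "indicator {..R^2} (y \<bullet> y) / sqrt (y \<bullet> y) = indicator (cball 0 R) y / norm y" for y :: "real^2"
    using True by (simp add: norm_eq_sqrt_inner[symmetric] dot_square_norm indicator_def)
  ultimately show ?thesis by simp
qed simp

lemma integrable_reflect_translate:
  fixes g :: "'a::euclidean_space \<Rightarrow> 'b::{banach, second_countable_topology}"
  assumes "integrable lborel g"
  shows "integrable lborel (\<lambda>y. g (x - y))"
proof -
  have "(lborel :: 'a measure) = density (distr lborel borel (\<lambda>y. x - y)) (\<lambda>_. 1)"
    by (subst lborel_affine[of "-1" x]) simp_all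
  then have "distr lborel borel (\<lambda>y. x - y) = (lborel :: 'a measure)"
    by (metis density_1)
  then have "integrable (distr lborel borel (\<lambda>y. x - y)) g"
    using assms by metis
  then show ?thesis
    by (rule integrable_distr[rotated]) measurable
qed

text \<open>The common majorant for all kernels below, with support around the origin but
  singularity at an arbitrary \<open>x\<close>. The ball of radius \<open>R\<close> around
  \<open>0\<close> lies in the ball of radius \<open>norm x + R\<close> around \<open>x\<close>, so
  recentring at \<open>x\<close> reduces to the singularity at the origin.\<close>

lemma integrable_bounded_over_norm:
  fixes h :: "real^2 \<Rightarrow> 'b::{banach, second_countable_topology}"
  assumes [measurable]: "h \<in> borel_measurable borel"
    and bound: "\<And>y. norm (h y) \<le> B * indicator (cball 0 R) y / norm (x - y)"
  shows "integrable lborel h"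
proof (rule Bochner_Integration.integrable_bound)
  show "integrable lborel (\<lambda>y. B * (indicator (cball 0 (norm x + R)) (x - y) / norm (x - y)))"
    by (intro integrable_mult_right integrable_reflect_translate integrable_inverse_norm_ball)
  show "AE y in lborel. norm (h y) \<le> norm (B * (indicator (cball 0 (norm x + R)) (x - y) / norm (x - y)))"
  proof (rule AE_I2)
    fix y
    have "norm (x - y) \<le> norm x + R" if "norm y \<le> R"
      using norm_triangle_ineq4[of x y] that by simp
    moreover have "B * indicator (cball 0 R) y / norm (x - y) \<le> \<bar>B\<bar> * indicator (cball 0 R) y / norm (x - y)"
      by (intro divide_right_mono mult_right_mono) auto
    ultimately show "norm (h y) \<le> norm (B * (indicator (cball 0 (norm x + R)) (x - y) / norm (x - y)))"
      using bound[of y] by (auto simp: abs_mult split: split_indicator_asm split_indicator)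
  qed
qed simp

section \<open>Newton's theorem\<close>

text \<open>One step of the geometric expansion of \<open>1/(z - w)\<close>, in powers of
  \<open>w/z\<close> or of \<open>z/w\<close>, with exact remainder. Keeping the remainder avoids
  interchanging an infinite sum with an integral.\<close>

lemma newton_kernel_steps:
  fixes z w :: complex
  assumes "z \<noteq> w"
  shows "z \<noteq> 0 \<Longrightarrow> (w / z) ^ N * inverse (z - w) =
      w ^ N * inverse (z ^ Suc N) + (w / z) ^ Suc N * inverse (z - w)"
    and "w \<noteq> 0 \<Longrightarrow> (z / w) ^ N * inverse (z - w) =
      - (z ^ N) * inverse (w ^ Suc N) + (z / w) ^ Suc N * inverse (z - w)"
proof -
  have nz: "z - w \<noteq> 0" using assms by simp
  show "(w / z) ^ N * inverse (z - w) =
      w ^ N * inverse (z ^ Suc N) + (w / z) ^ Suc N * inverse (z - w)" if "z \<noteq> 0"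
    using that nz by (simp add: power_divide divide_simps) (simp add: algebra_simps)
  show "(z / w) ^ N * inverse (z - w) =
      - (z ^ N) * inverse (w ^ Suc N) + (z / w) ^ Suc N * inverse (z - w)" if "w \<noteq> 0"
    using that nz by (simp add: power_divide divide_simps) (simp add: algebra_simps)
qed

text \<open>Meant for the remainder integrals of the expansion: rotation invariance makes them
  independent of the index, and dominated convergence sends them to zero.\<close>

lemma integral_eventually_0:
  fixes T :: "nat \<Rightarrow> 'b::t2_space"
  assumes "\<And>n. T (Suc n) = T n" "T \<longlonglongrightarrow> l"
  shows "T 0 = l"
proof -
  have "T n = T 0" for n
    by (induction n) (use assms in auto)
  then have "T = (\<lambda>_. T 0)" by auto
  then show ?thesis
    using assms(2) by (metis LIMSEQ_const_iff)
qed

context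
  fixes \<rho> :: "real \<Rightarrow> real" and B R :: real
  assumes \<rho>_measurable [measurable]: "\<rho> \<in> borel_measurable borel"
    and \<rho>_bound: "\<And>s. \<bar>\<rho> s\<bar> \<le> B"
    and \<rho>_support: "\<And>s. s > R \<Longrightarrow> \<rho> s = 0"
begin

lemma charge_le_indicator:
  "\<bar>\<rho> (y \<bullet> y)\<bar> \<le> B * indicator (cball 0 (sqrt R)) (y :: real^2)"
proof (cases "y \<bullet> y \<le> R")
  case True
  then show ?thesis
    using \<rho>_bound[of "y \<bullet> y"] by (simp add: norm_eq_sqrt_inner)
next
  case False
  have "B \<ge> 0" using \<rho>_bound[of 0] by linarith
  then show ?thesis using False \<rho>_support[of "y \<bullet> y"] by simp
qed

lemma integrable_charge_bounded_over_norm: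
  fixes k :: "real^2 \<Rightarrow> complex"
  assumes [measurable]: "k \<in> borel_measurable borel"
    and "\<And>y. norm (k y) \<le> C / norm (x - y)"
  shows "integrable lborel (\<lambda>y. of_real (\<rho> (y \<bullet> y)) * k y)"
proof (rule integrable_bounded_over_norm)
  fix y :: "real^2"
  have "norm (complex_of_real (\<rho> (y \<bullet> y)) * k y) = \<bar>\<rho> (y \<bullet> y)\<bar> * norm (k y)"
    by (simp add: norm_mult)
  also have "\<dots> \<le> (B * indicator (cball 0 (sqrt R)) y) * (C / norm (x - y))"
    using charge_le_indicator[of y] assms(2)[of y] by (intro mult_mono) (auto intro: order_trans[rotated])
  finally show "norm (complex_of_real (\<rho> (y \<bullet> y)) * k y) \<le>
      (B * C) * indicator (cball 0 (sqrt R)) y / norm (x - y)"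
    by (simp add: mult_ac)
qed measurable

lemma integral_charge_tendsto_0:
  fixes k :: "nat \<Rightarrow> real^2 \<Rightarrow> complex"
  assumes [measurable]: "\<And>n. k n \<in> borel_measurable borel"
    and bound: "\<And>n y. norm (k n y) \<le> 1 / norm (x - y)"
    and lim: "\<And>y. (\<lambda>n. k n y) \<longlonglongrightarrow> 0"
  shows "(\<lambda>n. \<integral>y. of_real (\<rho> (y \<bullet> y)) * k n y \<partial>lborel) \<longlonglongrightarrow> 0"
proof -
  have "(\<lambda>n. \<integral>y. of_real (\<rho> (y \<bullet> y)) * k n y \<partial>lborel) \<longlonglongrightarrow> (\<integral>y. 0 \<partial>(lborel :: (real^2) measure))"
  proof (rule integral_dominated_convergence[where w = "\<lambda>y. norm (complex_of_real (\<rho> (y \<bullet> y)) * (1 / norm (x - y)))"])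
    show "integrable lborel (\<lambda>y. norm (complex_of_real (\<rho> (y \<bullet> y)) * (1 / norm (x - y))))"
      by (intro integrable_norm integrable_charge_bounded_over_norm[where C = 1 and x = x]) (auto simp: norm_divide)
    show "AE y in lborel. (\<lambda>n. of_real (\<rho> (y \<bullet> y)) * k n y) \<longlonglongrightarrow> 0"
      by (intro AE_I2 tendsto_mult_right_zero lim)
    show "AE y in lborel. norm (of_real (\<rho> (y \<bullet> y)) * k n y) \<le>
        norm (complex_of_real (\<rho> (y \<bullet> y)) * (1 / norm (x - y)))" for n
      unfolding norm_mult using bound by (intro AE_I2 mult_left_mono) (auto simp: norm_divide)
  qed auto
  then show ?thesis by simp
qed

text \<open>Charge closer to the origin than \<open>x\<close> acts as if concentrated at the origin:
  in the expansion in powers of \<open>w/z\<close> only the leading term \<open>1/z\<close>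
  survives, since positive powers of \<open>w\<close> integrate to zero against a radial
  charge.\<close>

lemma integral_inner_charge_kernel:
  fixes x :: "real^2"
  defines "z \<equiv> plane_to_complex x"
  shows "(\<integral>y. of_real (\<rho> (y \<bullet> y)) * (indicator {..<x \<bullet> x} (y \<bullet> y) * inverse (z - plane_to_complex y)) \<partial>lborel) =
    inverse z * of_real (\<integral>y. indicator {..<x \<bullet> x} (y \<bullet> y) * \<rho> (y \<bullet> y) \<partial>(lborel :: (real^2) measure))"
proof (cases "x = 0")
  case False
  have z: "z \<noteq> 0" using False by (simp add: z_def)
  define I :: "real^2 \<Rightarrow> complex" where "I y = indicator {..<x \<bullet> x} (y \<bullet> y)" for y
  \<comment> \<open>The remainder after \<open>N\<close> terms; \<open>T 0\<close> is the integral
    to be computed.\<close>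
  define T where "T N = (\<integral>y. of_real (\<rho> (y \<bullet> y)) * (I y * ((plane_to_complex y / z) ^ N * inverse (z - plane_to_complex y))) \<partial>lborel)" for N
  have [measurable]: "I \<in> borel_measurable borel"
    unfolding I_def by measurable
  have in_disc: "norm (plane_to_complex y) < norm z" if "I y \<noteq> 0" for y
    using that unfolding I_def z_def norm_plane_to_complex by (auto simp: norm_lt split: split_indicator_asm)
  have norm_I: "norm (I y) \<le> 1" for y
    by (simp add: I_def split: split_indicator)
  have nrm: "norm (z - plane_to_complex y) = norm (x - y)" for y
    by (metis z_def norm_plane_to_complex plane_to_complex_simps(2))
  have kbound: "norm (I y * ((plane_to_complex y / z) ^ N * inverse (z - plane_to_complex y))) \<le> 1 / norm (x - y)" for y N
  proof (cases "I y = 0")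
    case False
    then have "norm (plane_to_complex y / z) ^ N \<le> 1"
      using in_disc z by (intro power_le_one) (auto simp: norm_divide less_imp_le)
    then have "norm (I y) * (norm (plane_to_complex y / z) ^ N * inverse (norm (x - y))) \<le> 1 * (1 * inverse (norm (x - y)))"
      using norm_I by (intro mult_mono) auto
    then show ?thesis
      by (simp add: norm_mult norm_power norm_inverse nrm divide_inverse)
  qed simp
  \<comment> \<open>The constant \<open>2\<close> comes from
    \<open>|x - y| \<le> |x| + |y| \<le> 2 |x|\<close> for \<open>|y| < |x|\<close>; it lets the
    general integrability lemma cover this nonsingular term as well.\<close>
  have pbound: "norm (I y * (plane_to_complex y ^ N * inverse (z ^ Suc N))) \<le> 2 / norm (x - y)" for y N
  proof (cases "I y = 0 \<or> x = y")
    case False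
    then have lt: "norm (plane_to_complex y) < norm z" using in_disc by blast
    then have "norm (plane_to_complex y / z) ^ N \<le> 1"
      using z by (intro power_le_one) (auto simp: norm_divide less_imp_le)
    moreover have "norm (x - y) \<le> 2 * norm z"
      using norm_triangle_ineq4[of x y] lt by (simp add: norm_plane_to_complex z_def)
    then have "inverse (norm z) \<le> 2 / norm (x - y)"
      using z False by (simp add: field_simps)
    ultimately have "norm (I y) * (norm (plane_to_complex y / z) ^ N * inverse (norm z)) \<le> 1 * (1 * (2 / norm (x - y)))"
      using norm_I by (intro mult_mono) auto
    then show ?thesis
      by (simp add: norm_mult norm_power norm_inverse norm_divide power_divide divide_inverse power_inverse power_mult_distrib mult_ac)
  qed (use False in \<open>auto simp: I_def\<close>)
  have step: "T N = (\<integral>y. of_real (\<rho> (y \<bullet> y)) * (I y * (plane_to_complex y ^ N * inverse (z ^ Suc N))) \<partial>lborel) + T (Suc N)" for N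
    unfolding T_def
  proof (subst Bochner_Integration.integral_add[symmetric])
    show "integrable lborel (\<lambda>y. of_real (\<rho> (y \<bullet> y)) * (I y * (plane_to_complex y ^ N * inverse (z ^ Suc N))))"
      by (rule integrable_charge_bounded_over_norm[OF _ pbound]) measurable
    show "integrable lborel (\<lambda>y. of_real (\<rho> (y \<bullet> y)) * (I y * ((plane_to_complex y / z) ^ Suc N * inverse (z - plane_to_complex y))))"
      by (rule integrable_charge_bounded_over_norm[OF _ kbound]) measurable
    have "I y * ((plane_to_complex y / z) ^ N * inverse (z - plane_to_complex y)) =
      I y * (plane_to_complex y ^ N * inverse (z ^ Suc N)) + I y * ((plane_to_complex y / z) ^ Suc N * inverse (z - plane_to_complex y))" for y
    proof (cases "I y = 0")
      case False
      then have "z \<noteq> plane_to_complex y" using in_disc by fastforce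
      from newton_kernel_steps(1)[OF this z, of N] show ?thesis
        by (simp only: distrib_left)
    qed simp
    then show "(\<integral>y. of_real (\<rho> (y \<bullet> y)) * (I y * ((plane_to_complex y / z) ^ N * inverse (z - plane_to_complex y))) \<partial>lborel) =
      (\<integral>y. of_real (\<rho> (y \<bullet> y)) * (I y * (plane_to_complex y ^ N * inverse (z ^ Suc N))) +
        of_real (\<rho> (y \<bullet> y)) * (I y * ((plane_to_complex y / z) ^ Suc N * inverse (z - plane_to_complex y))) \<partial>lborel)"
      by (simp only: distrib_left)
  qed
  \<comment> \<open>Constant only from index \<open>1\<close> on: the step from \<open>0\<close> to
    \<open>1\<close> releases the surviving term.\<close>
  have "T (Suc (Suc N)) = T (Suc N)" for N
  proof -
    have "(\<integral>y. of_real (\<rho> (y \<bullet> y)) * (I y * (plane_to_complex y ^ Suc N * inverse (z ^ Suc (Suc N)))) \<partial>lborel) =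
      (\<integral>y. (of_real (\<rho> (y \<bullet> y)) * indicator {..<x \<bullet> x} (y \<bullet> y) * inverse (z ^ Suc (Suc N))) * plane_to_complex y ^ Suc N \<partial>lborel)"
      by (simp only: I_def mult_ac)
    also have "\<dots> = 0"
      by (rule integral_radial_times_power_eq_0(1)[where h = "\<lambda>s. of_real (\<rho> s) * indicator {..<x \<bullet> x} s * inverse (z ^ Suc (Suc N))"]) auto
    finally show ?thesis
      using step[of "Suc N"] by simp
  qed
  moreover have "T \<longlonglongrightarrow> 0"
    unfolding T_def
  proof (rule integral_charge_tendsto_0[OF _ kbound])
    show "(\<lambda>n. I y * ((plane_to_complex y / z) ^ n * inverse (z - plane_to_complex y))) \<longlonglongrightarrow> 0" for y
    proof (cases "I y = 0")
      case False
      then have "norm (plane_to_complex y / z) < 1"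
        using in_disc z by (simp add: norm_divide)
      then show ?thesis
        by (intro tendsto_mult_right_zero tendsto_mult_left_zero LIMSEQ_power_zero)
    qed simp
  qed measurable
  then have "(\<lambda>n. T (Suc n)) \<longlonglongrightarrow> 0"
    by (rule LIMSEQ_Suc)
  ultimately have "T (Suc 0) = 0"
    by (rule integral_eventually_0)
  then have "T 0 = (\<integral>y. inverse z * of_real (indicator {..<x \<bullet> x} (y \<bullet> y) * \<rho> (y \<bullet> y)) \<partial>(lborel :: (real^2) measure))"
    using step[of 0] by (simp add: I_def mult_ac of_real_indicator)
  also have "\<dots> = inverse z * of_real (\<integral>y. indicator {..<x \<bullet> x} (y \<bullet> y) * \<rho> (y \<bullet> y) \<partial>(lborel :: (real^2) measure))"
    by (simp only: integral_mult_right_zero integral_complex_of_real)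
  finally show ?thesis
    by (simp add: T_def I_def)
qed (simp add: indicator_def leD[OF inner_ge_zero])

text \<open>Charge farther out than \<open>x\<close> exerts no net force: every term of the
  expansion in \<open>z/w\<close>, the leading one included, carries a negative power of
  \<open>w\<close> and integrates to zero.\<close>

lemma integral_outer_charge_kernel:
  fixes x :: "real^2"
  defines "z \<equiv> plane_to_complex x"
  shows "(\<integral>y. of_real (\<rho> (y \<bullet> y)) * (indicator {x \<bullet> x<..} (y \<bullet> y) * inverse (z - plane_to_complex y)) \<partial>lborel) = 0"
proof -
  define I :: "real^2 \<Rightarrow> complex" where "I y = indicator {x \<bullet> x<..} (y \<bullet> y)" for y
  define T where "T N = (\<integral>y. of_real (\<rho> (y \<bullet> y)) * (I y * ((z / plane_to_complex y) ^ N * inverse (z - plane_to_complex y))) \<partial>lborel)" for N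
  have [measurable]: "I \<in> borel_measurable borel"
    unfolding I_def by measurable
  have out_disc: "norm z < norm (plane_to_complex y)" if "I y \<noteq> 0" for y
    using that unfolding I_def z_def norm_plane_to_complex by (auto simp: norm_lt split: split_indicator_asm)
  have norm_I: "norm (I y) \<le> 1" for y
    by (simp add: I_def split: split_indicator)
  have nrm: "norm (z - plane_to_complex y) = norm (x - y)" for y
    by (metis z_def norm_plane_to_complex plane_to_complex_simps(2))
  have ratio: "norm (I y) * (norm (z / plane_to_complex y) ^ N * a) \<le> a" if "a \<ge> 0" for y N and a :: real
  proof (cases "I y = 0")
    case False
    then have "norm (z / plane_to_complex y) ^ N \<le> 1"
      using out_disc[of y] by (intro power_le_one) (auto simp: norm_divide divide_le_eq_1)
    then have "norm (I y) * (norm (z / plane_to_complex y) ^ N * a) \<le> 1 * (1 * a)"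
      using norm_I that by (intro mult_mono) auto
    then show ?thesis by simp
  qed (use that in simp)
  have kbound: "norm (I y * ((z / plane_to_complex y) ^ N * inverse (z - plane_to_complex y))) \<le> 1 / norm (x - y)" for y N
    using ratio[of "inverse (norm (x - y))" y N]
    by (simp add: norm_mult norm_power norm_inverse nrm divide_inverse)
  \<comment> \<open>These terms are controlled by \<open>1/|y|\<close>, so the majorant is centred
    at \<open>0\<close> instead of \<open>x\<close>.\<close>
  have pbound: "norm (I y * (- (z ^ N) * inverse (plane_to_complex y ^ Suc N))) \<le> 1 / norm (0 - y)" for y N
    using ratio[of "inverse (norm y)" y N]
    by (simp add: norm_mult norm_power norm_inverse norm_divide power_divide divide_inverse power_inverse power_mult_distrib mult_ac norm_plane_to_complex)
  have step: "T N = (\<integral>y. of_real (\<rho> (y \<bullet> y)) * (I y * (- (z ^ N) * inverse (plane_to_complex y ^ Suc N))) \<partial>lborel) + T (Suc N)" for N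
    unfolding T_def
  proof (subst Bochner_Integration.integral_add[symmetric])
    show "integrable lborel (\<lambda>y. of_real (\<rho> (y \<bullet> y)) * (I y * (- (z ^ N) * inverse (plane_to_complex y ^ Suc N))))"
      by (rule integrable_charge_bounded_over_norm[OF _ pbound]) measurable
    show "integrable lborel (\<lambda>y. of_real (\<rho> (y \<bullet> y)) * (I y * ((z / plane_to_complex y) ^ Suc N * inverse (z - plane_to_complex y))))"
      by (rule integrable_charge_bounded_over_norm[OF _ kbound]) measurable
    have "I y * ((z / plane_to_complex y) ^ N * inverse (z - plane_to_complex y)) =
      I y * (- (z ^ N) * inverse (plane_to_complex y ^ Suc N)) + I y * ((z / plane_to_complex y) ^ Suc N * inverse (z - plane_to_complex y))" for y
    proof (cases "I y = 0")
      case False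
      then have "z \<noteq> plane_to_complex y" "plane_to_complex y \<noteq> 0" using out_disc by fastforce+
      from newton_kernel_steps(2)[OF this, of N] show ?thesis
        by (simp only: distrib_left)
    qed simp
    then show "(\<integral>y. of_real (\<rho> (y \<bullet> y)) * (I y * ((z / plane_to_complex y) ^ N * inverse (z - plane_to_complex y))) \<partial>lborel) =
      (\<integral>y. of_real (\<rho> (y \<bullet> y)) * (I y * (- (z ^ N) * inverse (plane_to_complex y ^ Suc N))) +
        of_real (\<rho> (y \<bullet> y)) * (I y * ((z / plane_to_complex y) ^ Suc N * inverse (z - plane_to_complex y))) \<partial>lborel)"
      by (simp only: distrib_left)
  qed
  have "T (Suc N) = T N" for N
  proof -
    have "(\<integral>y. of_real (\<rho> (y \<bullet> y)) * (I y * (- (z ^ N) * inverse (plane_to_complex y ^ Suc N))) \<partial>lborel) =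
      (\<integral>y. (of_real (\<rho> (y \<bullet> y)) * indicator {x \<bullet> x<..} (y \<bullet> y) * - (z ^ N)) * inverse (plane_to_complex y ^ Suc N) \<partial>lborel)"
      by (simp only: I_def mult_ac)
    also have "\<dots> = 0"
      by (rule integral_radial_times_power_eq_0(2)[where h = "\<lambda>s. of_real (\<rho> s) * indicator {x \<bullet> x<..} s * - (z ^ N)"]) auto
    finally show ?thesis
      using step[of N] by simp
  qed
  moreover have "T \<longlonglongrightarrow> 0"
    unfolding T_def
  proof (rule integral_charge_tendsto_0[OF _ kbound])
    show "(\<lambda>n. I y * ((z / plane_to_complex y) ^ n * inverse (z - plane_to_complex y))) \<longlonglongrightarrow> 0" for y
    proof (cases "I y = 0")
      case False
      then have "norm (z / plane_to_complex y) < 1"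
        using out_disc[of y] by (auto simp: norm_divide divide_less_eq_1)
      then show ?thesis
        by (intro tendsto_mult_right_zero tendsto_mult_left_zero LIMSEQ_power_zero)
    qed simp
  qed measurable
  ultimately have "T 0 = 0"
    by (rule integral_eventually_0)
  then show ?thesis
    by (simp add: T_def I_def)
qed

lemma integral_charge_kernel:
  fixes x :: "real^2"
  defines "z \<equiv> plane_to_complex x"
  shows "integrable lborel (\<lambda>y. of_real (\<rho> (y \<bullet> y)) * inverse (z - plane_to_complex y))" (is "integrable _ ?k")
    and "(\<integral>y. of_real (\<rho> (y \<bullet> y)) * inverse (z - plane_to_complex y) \<partial>lborel) =
      inverse z * of_real (pi * (\<integral>s. indicator {0..<x \<bullet> x} s * \<rho> s \<partial>lborel))"
proof -
  have nrm: "norm (z - plane_to_complex y) = norm (x - y)" for y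
    by (metis z_def norm_plane_to_complex plane_to_complex_simps(2))
  have int: "integrable lborel (\<lambda>y. of_real (\<rho> (y \<bullet> y)) * (J (y \<bullet> y) * inverse (z - plane_to_complex y)))"
    if [measurable]: "J \<in> borel_measurable borel" and "\<And>s. norm (J s) \<le> 1" for J :: "real \<Rightarrow> complex"
  proof (rule integrable_charge_bounded_over_norm)
    show "norm (J (y \<bullet> y) * inverse (z - plane_to_complex y)) \<le> 1 / norm (x - y)" for y
      using mult_right_mono[OF that(2), of "inverse (norm (x - y))"]
      by (simp add: norm_mult norm_inverse nrm divide_inverse)
  qed measurable
  from int[of "\<lambda>_. 1"] show "integrable lborel ?k" by simp
  \<comment> \<open>The inner and the outer region together miss only the circle through
    \<open>x\<close>, a null set.\<close>
  have "(\<integral>y. ?k y \<partial>lborel) =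
    (\<integral>y. of_real (\<rho> (y \<bullet> y)) * (indicator {..<x \<bullet> x} (y \<bullet> y) * inverse (z - plane_to_complex y)) +
      of_real (\<rho> (y \<bullet> y)) * (indicator {x \<bullet> x<..} (y \<bullet> y) * inverse (z - plane_to_complex y)) \<partial>lborel)"
    by (intro integral_cong_AE) (use AE_inner_self_neq[of "x \<bullet> x"] in \<open>auto elim!: eventually_mono simp: indicator_def\<close>)
  also have "\<dots> = inverse z * of_real (\<integral>y. indicator {..<x \<bullet> x} (y \<bullet> y) * \<rho> (y \<bullet> y) \<partial>(lborel :: (real^2) measure)) + 0"
    unfolding z_def integral_inner_charge_kernel[symmetric] integral_outer_charge_kernel[of x, symmetric]
    unfolding z_def[symmetric]
    by (intro Bochner_Integration.integral_add int) (auto split: split_indicator)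
  also have "(\<integral>y. indicator {..<x \<bullet> x} (y \<bullet> y) * \<rho> (y \<bullet> y) \<partial>(lborel :: (real^2) measure)) =
      pi * (\<integral>s. indicator {0..<x \<bullet> x} s * \<rho> s \<partial>lborel)"
    by (subst integral_inner_self[where h = "\<lambda>s. indicator {..<x \<bullet> x} s * \<rho> s"])
      (auto intro!: Bochner_Integration.integral_cong split: split_indicator)
  finally show "(\<integral>y. ?k y \<partial>lborel) = inverse z * of_real (pi * (\<integral>s. indicator {0..<x \<bullet> x} s * \<rho> s \<partial>lborel))"
    by simp
qed

text \<open>As a complex number, \<open>K w\<close> is the conjugate of \<open>1 / (2 * pi * w)\<close>.\<close>

lemma radial_charge_field:
  fixes x :: "real^2"
  shows "has_bochner_integral lborel (\<lambda>y. \<rho> (y \<bullet> y) *\<^sub>R K (x - y))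
    (((\<integral>s. indicator {0..<x \<bullet> x} s * \<rho> s \<partial>lborel) / (2 * (x \<bullet> x))) *\<^sub>R x)"
proof -
  define L where "L w = complex_to_plane (cnj w * of_real (1 / (2 * pi)))" for w
  have L: "bounded_linear L"
    unfolding L_def
    by (intro bounded_linear_compose[OF bounded_linear_complex_to_plane]
        bounded_linear_compose[OF bounded_linear_mult_left] bounded_linear_cnj)
  have Lr: "L (of_real a * w) = a *\<^sub>R L w" for a w
    using linear_scale[OF bounded_linear.linear[OF L], of a w] by (simp add: scaleR_conv_of_real)
  have LK: "L (inverse (plane_to_complex w)) = K w" for w
    by (simp add: L_def K_def complex_to_plane_def plane_to_complex_def vec_eq_iff forall_2
        norm_vec_def L2_set_def sum_2 power2_eq_square)
  let ?z = "plane_to_complex x" and ?Q = "\<integral>s. indicator {0..<x \<bullet> x} s * \<rho> s \<partial>lborel"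
  have "has_bochner_integral lborel (\<lambda>y. L (of_real (\<rho> (y \<bullet> y)) * inverse (?z - plane_to_complex y)))
     (L (inverse ?z * of_real (pi * ?Q)))"
    using integral_charge_kernel[of x]
    by (intro has_bochner_integral_bounded_linear[OF L]) (auto simp: has_bochner_integral_iff)
  moreover have "L (inverse ?z * of_real (pi * ?Q)) = (?Q / (2 * (x \<bullet> x))) *\<^sub>R x"
    by (simp only: mult.commute[of "inverse ?z"] Lr LK) (simp add: K_def dot_square_norm)
  moreover have "L (of_real (\<rho> (y \<bullet> y)) * inverse (?z - plane_to_complex y)) = \<rho> (y \<bullet> y) *\<^sub>R K (x - y)" for y
    by (simp only: Lr LK plane_to_complex_simps(2)[symmetric])
  ultimately show ?thesis by simp
qed

end

section \<open>Global solutions of Lipschitz differential equations\<close>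

text \<open>Integration preserves an exponential bound and gains the factor
  \<open>1 / \<mu>\<close>; with a large enough rate this gain beats the Lipschitz constant.\<close>

lemma norm_integral_le_exp:
  fixes g :: "real \<Rightarrow> 'a::euclidean_space"
  assumes "continuous_on {0..t} g" "0 < \<mu>" "0 \<le> t"
    and bound: "\<And>s. 0 \<le> s \<Longrightarrow> s \<le> t \<Longrightarrow> norm (g s) \<le> M * exp (\<mu> * s)"
  shows "norm (integral {0..t} g) \<le> M / \<mu> * exp (\<mu> * t)"
proof -
  have "norm (g 0) \<le> M"
    using bound[of 0] \<open>0 \<le> t\<close> by simp
  then have M: "0 \<le> M"
    using norm_ge_zero order_trans by blast
  have int: "((\<lambda>s. M * exp (\<mu> * s)) has_integral (M / \<mu> * exp (\<mu> * t) - M / \<mu> * exp (\<mu> * 0))) {0..t}"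
    using assms
    by (intro fundamental_theorem_of_calculus)
      (auto intro!: derivative_eq_intros simp: has_real_derivative_iff_has_vector_derivative[symmetric])
  have "norm (integral {0..t} g) \<le> integral {0..t} (\<lambda>s. M * exp (\<mu> * s))"
    using assms int by (intro integral_norm_bound_integral integrable_continuous_interval)
      (auto intro!: continuous_intros)
  also have "\<dots> \<le> M / \<mu> * exp (\<mu> * t)"
    unfolding integral_unique[OF int] using M \<open>0 < \<mu>\<close> by simp
  finally show ?thesis .
qed

text \<open>The Picard operator is a contraction for the weight \<open>exp (2 * L * t)\<close>; the fixed point
  is the weighted solution.\<close>

lemma lipschitz_ode_forward:
  fixes A :: "'a::euclidean_space \<Rightarrow> 'a"
  assumes lip: "\<And>x y. norm (A x - A y) \<le> L * norm (x - y)" and L: "0 < L"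
  obtains y where "y 0 = y0" "\<And>t. 0 \<le> t \<Longrightarrow> (y has_vector_derivative A (y t)) (at t within {0..})"
proof -
  have contA: "continuous_on S A" for S
    by (rule lipschitz_on_continuous_on[of L], rule lipschitz_onI)
      (use lip L in \<open>auto simp: dist_norm\<close>)
  define \<mu> where "\<mu> = 2 * L"
  have \<mu>: "0 < \<mu>" using L by (simp add: \<mu>_def)
  have cancel: "exp (- a) * (c * exp a) = c" for a c :: real
    by (simp add: exp_minus)
  \<comment> \<open>The weight is moved into the ansatz, so that the weighted norm of
    \<open>y - y0\<close> is the supremum norm of \<open>w\<close> and the complete space of bounded
    continuous functions can be used.\<close>
  define y where "y w t = y0 + exp (\<mu> * t) *\<^sub>R apply_bcontfun w t" for w :: "real \<Rightarrow>\<^sub>C 'a" and t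
  have conty: "continuous_on S (\<lambda>s. A (y w s))" for S w
    unfolding y_def
    by (rule continuous_on_compose2[OF contA[of UNIV]])
      (auto intro!: continuous_intros continuous_on_subset[OF continuous_on_apply_bcontfun])
  \<comment> \<open>Using \<open>max t 0\<close> extends the operator continuously to negative
    times, as the function space lives on the whole line.\<close>
  define T where "T w t = exp (- (\<mu> * max t 0)) *\<^sub>R integral {0..max t 0} (\<lambda>s. A (y w s))" for w t
  have contI: "continuous_on {0..} (\<lambda>t. integral {0..t} (\<lambda>s. A (y w s)))" for w
  proof -
    have cont: "continuous_on {0..b} (\<lambda>t. integral {0..t} (\<lambda>s. A (y w s)))" for b
      by (intro indefinite_integral_continuous_1 integrable_continuous_interval conty)
    then have "continuous (at t within {0..}) (\<lambda>t. integral {0..t} (\<lambda>s. A (y w s)))" if "t \<in> {0..}" for t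
    proof -
      have "at t within {0..} = at t within {0..t + 1}"
        using that by (intro at_within_nhd[of _ "{..<t + 1}"]) auto
      then show ?thesis
        using cont[of "t + 1"] that by (auto simp: continuous_on_eq_continuous_within)
    qed
    then show ?thesis
      by (simp add: continuous_on_eq_continuous_within)
  qed
  have T_bcontfun: "T w \<in> bcontfun" for w
  proof (rule bcontfun_normI)
    show "continuous_on UNIV (T w)"
      unfolding T_def
      by (intro continuous_intros continuous_on_compose2[OF contI]) auto
    fix t :: real
    let ?t = "max t 0"
    have "norm (A (y w s)) \<le> (norm (A y0) + L * norm w) * exp (\<mu> * s)" if "0 \<le> s" for s
    proof -
      have "norm (A (y w s)) \<le> norm (A y0) + norm (A (y w s) - A y0)"
        using norm_triangle_ineq[of "A y0" "A (y w s) - A y0"] by simp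
      also have "norm (A (y w s) - A y0) \<le> L * (exp (\<mu> * s) * norm (apply_bcontfun w s))"
        using lip[of "y w s" y0] by (simp add: y_def)
      also have "\<dots> \<le> L * (exp (\<mu> * s) * norm w)"
        using L by (intro mult_left_mono norm_bounded) auto
      also have "norm (A y0) \<le> norm (A y0) * exp (\<mu> * s)"
        using mult_left_mono[of 1 "exp (\<mu> * s)" "norm (A y0)"] that \<mu> by simp
      finally show ?thesis by (simp add: algebra_simps)
    qed
    then have "norm (integral {0..?t} (\<lambda>s. A (y w s))) \<le> (norm (A y0) + L * norm w) / \<mu> * exp (\<mu> * ?t)"
      by (intro norm_integral_le_exp conty \<mu>) auto
    then have "exp (- (\<mu> * ?t)) * norm (integral {0..?t} (\<lambda>s. A (y w s))) \<le>
        exp (- (\<mu> * ?t)) * ((norm (A y0) + L * norm w) / \<mu> * exp (\<mu> * ?t))"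
      by (intro mult_left_mono) auto
    then show "norm (T w t) \<le> (norm (A y0) + L * norm w) / \<mu>"
      unfolding cancel by (simp add: T_def)
  qed
  define F where "F w = Bcontfun (T w)" for w
  have F: "apply_bcontfun (F w) = T w" for w
    unfolding F_def by (rule Bcontfun_inverse[OF T_bcontfun])
  have "dist (F v) (F w) \<le> 1/2 * dist v w" for v w
  proof (rule dist_bound)
    fix t :: real
    let ?t = "max t 0"
    have "norm (A (y v s) - A (y w s)) \<le> (L * dist v w) * exp (\<mu> * s)" for s
    proof -
      have "norm (A (y v s) - A (y w s)) \<le> L * (exp (\<mu> * s) * dist (apply_bcontfun v s) (apply_bcontfun w s))"
        using lip[of "y v s" "y w s"] by (simp add: y_def dist_norm scaleR_diff_right[symmetric])
      also have "\<dots> \<le> L * (exp (\<mu> * s) * dist v w)"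
        using L by (intro mult_left_mono dist_bounded) auto
      finally show ?thesis by (simp add: mult_ac)
    qed
    then have "norm (integral {0..?t} (\<lambda>s. A (y v s) - A (y w s))) \<le> (L * dist v w) / \<mu> * exp (\<mu> * ?t)"
      by (intro norm_integral_le_exp continuous_intros conty \<mu>) auto
    then have "exp (- (\<mu> * ?t)) * norm (integral {0..?t} (\<lambda>s. A (y v s) - A (y w s))) \<le>
        exp (- (\<mu> * ?t)) * ((L * dist v w) / \<mu> * exp (\<mu> * ?t))"
      by (intro mult_left_mono) auto
    moreover have "T v t - T w t = exp (- (\<mu> * ?t)) *\<^sub>R integral {0..?t} (\<lambda>s. A (y v s) - A (y w s))"
      unfolding T_def
      by (subst integral_diff) (auto intro!: integrable_continuous_interval conty simp: scaleR_diff_right)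
    moreover have "exp (- (\<mu> * ?t)) * ((L * dist v w) / \<mu> * exp (\<mu> * ?t)) = 1/2 * dist v w"
      unfolding cancel using L by (simp add: \<mu>_def)
    ultimately show "dist (apply_bcontfun (F v) t) (apply_bcontfun (F w) t) \<le> 1/2 * dist v w"
      by (simp only: F dist_norm[of "T v t"] norm_scaleR abs_exp_cancel)
  qed
  then have "\<exists>!w. F w = w"
    by (intro banach_fix_type[of "1/2"]) auto
  then obtain w where w: "F w = w" by blast
  have eq: "y w t = y0 + integral {0..t} (\<lambda>s. A (y w s))" if "0 \<le> t" for t
  proof -
    have "apply_bcontfun w t = T w t"
      using F w by metis
    then show ?thesis
      using that unfolding y_def[of w t] by (simp add: T_def exp_minus)
  qed
  show ?thesis
  proof
    show "y w 0 = y0"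
      using eq[of 0] by simp
    fix t :: real assume t: "0 \<le> t"
    have "((\<lambda>t. y0 + integral {0..t} (\<lambda>s. A (y w s))) has_vector_derivative 0 + A (y w t)) (at t within {0..t + 1})"
      using t by (intro has_vector_derivative_add integral_has_vector_derivative conty) auto
    moreover have "at t within {0..} = at t within {0..t + 1}"
      using t by (intro at_within_nhd[of _ "{..<t + 1}"]) auto
    ultimately have "((\<lambda>t. y0 + integral {0..t} (\<lambda>s. A (y w s))) has_vector_derivative A (y w t)) (at t within {0..})"
      by simp
    then show "(y w has_vector_derivative A (y w t)) (at t within {0..})"
      using eq t by (rule_tac has_vector_derivative_transform) auto
  qed
qed

lemma has_vector_derivative_left_right:
  assumes "(f has_vector_derivative d) (at x within {..x})" "(f has_vector_derivative d) (at x within {x..})"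
  shows "(f has_vector_derivative d) (at (x::real))"
proof -
  have "(f has_vector_derivative d) (at x within {..x} \<union> {x..})"
    using assms unfolding has_vector_derivative_def has_derivative_within Lim_within_Un by blast
  moreover have "{..x} \<union> {x..} = UNIV" by auto
  ultimately show ?thesis by simp
qed

text \<open>Negative times are covered by solving forward with \<open>- A\<close> and reversing
  time. Both halves have the one-sided derivative \<open>A y0\<close> at \<open>0\<close>, so they
  join differentiably.\<close>

lemma lipschitz_ode_global:
  fixes A :: "'a::euclidean_space \<Rightarrow> 'a"
  assumes lip: "\<And>x y. norm (A x - A y) \<le> L * norm (x - y)" and L: "0 < L"
  shows "\<exists>y. y 0 = y0 \<and> (\<forall>t. (y has_vector_derivative A (y t)) (at t))"
proof -
  obtain u where u: "u 0 = y0" "\<And>t. 0 \<le> t \<Longrightarrow> (u has_vector_derivative A (u t)) (at t within {0..})"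
    using lipschitz_ode_forward[OF lip L] by blast
  have "norm (- A x - - A y) \<le> L * norm (x - y)" for x y
    using lip[of y x] by (simp add: norm_minus_commute)
  then obtain v where v: "v 0 = y0" "\<And>t. 0 \<le> t \<Longrightarrow> (v has_vector_derivative - A (v t)) (at t within {0..})"
    using lipschitz_ode_forward[of "\<lambda>x. - A x" L y0] L by blast
  define y where "y t = (if 0 \<le> t then u t else v (- t))" for t
  have right: "(y has_vector_derivative A (y t)) (at t within {0..})" if "0 \<le> t" for t
  proof -
    have "(y has_vector_derivative A (u t)) (at t within {0..})"
      by (rule has_vector_derivative_transform[OF _ _ u(2)]) (use that in \<open>auto simp: y_def\<close>)
    then show ?thesis using that by (simp add: y_def)
  qed
  have left: "(y has_vector_derivative A (y t)) (at t within {..0})" if "t \<le> 0" for t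
  proof -
    have "uminus ` {..0::real} = {0..}" by force
    then have "(v has_vector_derivative - A (v (- t))) (at (- t) within uminus ` {..0})"
      using v(2)[of "- t"] that by simp
    from vector_diff_chain_within[OF has_vector_derivative_minus[OF has_vector_derivative_id] this]
    have "((\<lambda>t. v (- t)) has_vector_derivative A (v (- t))) (at t within {..0})"
      by (simp add: o_def)
    then have "(y has_vector_derivative A (v (- t))) (at t within {..0})"
      by (rule has_vector_derivative_transform[rotated 2]) (use that u v in \<open>auto simp: y_def\<close>)
    moreover have "y t = v (- t)"
      using that u v by (auto simp: y_def)
    ultimately show ?thesis by simp
  qed
  have "(y has_vector_derivative A (y t)) (at t)" for t
  proof (cases t "0 :: real" rule: linorder_cases)
    case less
    then show ?thesis
      using left[of t] at_within_open_subset[of t "{..<0}" "{..0}"] by fastforce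
  next
    case equal
    then show ?thesis
      using left[of t] right[of t] by (intro has_vector_derivative_left_right) auto
  next
    case greater
    then show ?thesis
      using right[of t] at_within_open_subset[of t "{0<..}" "{0..}"] by fastforce
  qed
  moreover have "y 0 = y0"
    by (simp add: y_def u)
  ultimately show ?thesis by blast
qed

section \<open>The steady state\<close>

lemma grad_radial:
  fixes h :: "real \<Rightarrow> real"
  assumes "(h has_real_derivative d) (at (x \<bullet> x))"
  shows "grad (\<lambda>y. h (y \<bullet> y)) x = (2 * d) *\<^sub>R x"
proof -
  have "((\<lambda>y. h (y \<bullet> y)) has_derivative (\<lambda>v. d * (x \<bullet> v + v \<bullet> x))) (at x)"
    by (rule has_derivative_compose[OF has_derivative_inner[OF has_derivative_ident has_derivative_ident]])
      (use assms in \<open>simp add: has_field_derivative_def\<close>)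
  then have "partial_deriv b (\<lambda>y. h (y \<bullet> y)) x = (2 * d) * (x \<bullet> b)" for b
    using partial_deriv_eq_frechet_derivative by (fastforce simp: inner_commute)
  then show ?thesis
    unfolding grad_def
    by (simp add: scaleR_scaleR[symmetric] scaleR_sum_right[symmetric] euclidean_representation del: scaleR_scaleR)
qed

lemma partial_deriv_pot_inner_self:
  "partial_deriv b (\<lambda>y. pot (y \<bullet> y)) x = 2 * (x \<bullet> b) * inverse (profile (x \<bullet> x))"
proof -
  have "((\<lambda>y. pot (y \<bullet> y)) has_derivative (\<lambda>v. inverse (profile (x \<bullet> x)) * (x \<bullet> v + v \<bullet> x))) (at x)"
    by (rule has_derivative_compose[OF has_derivative_inner[OF has_derivative_ident has_derivative_ident]])
      (use pot_deriv in \<open>simp add: has_field_derivative_def\<close>)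
  from partial_deriv_eq_frechet_derivative[OF this] show ?thesis
    by (simp add: inner_commute)
qed

lemma profile_inner_self_has_derivative:
  "((\<lambda>y. inverse (profile (y \<bullet> y))) has_derivative
    (\<lambda>v. - (2 * profile' (x \<bullet> x) * (x \<bullet> v) * inverse (profile (x \<bullet> x)) ^ 2))) (at x)"
proof -
  have "((\<lambda>s. inverse (profile s)) has_real_derivative
      - (profile' (x \<bullet> x) * inverse (profile (x \<bullet> x)) ^ 2)) (at (x \<bullet> x))"
    using profile_pos[of "x \<bullet> x"] by (auto intro!: derivative_eq_intros simp: power2_eq_square)
  then have "((\<lambda>s. inverse (profile s)) has_derivative
      (*) (- (profile' (x \<bullet> x) * inverse (profile (x \<bullet> x)) ^ 2))) (at (x \<bullet> x))"
    by (simp add: has_field_derivative_def)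
  from has_derivative_compose[OF has_derivative_inner[OF has_derivative_ident has_derivative_ident] this]
  show ?thesis
    by (simp add: inner_commute algebra_simps)
qed

lemma laplacian_pot_inner_self:
  "laplacian (\<lambda>y::real^2. pot (y \<bullet> y)) x = neg_charge (x \<bullet> x)"
proof -
  let ?q = "profile (x \<bullet> x)" and ?q' = "profile' (x \<bullet> x)"
  have "partial_deriv b (\<lambda>y::real^2. 2 * (y \<bullet> b) * inverse (profile (y \<bullet> y))) x =
      2 * (b \<bullet> b) * inverse ?q - 4 * ?q' * inverse ?q ^ 2 * ((x \<bullet> b) * (x \<bullet> b))" for b
  proof -
    have "((\<lambda>y::real^2. 2 * (y \<bullet> b) * inverse (profile (y \<bullet> y))) has_derivative
      (\<lambda>v. 2 * (x \<bullet> b) * - (2 * ?q' * (x \<bullet> v) * inverse ?q ^ 2) + 2 * (v \<bullet> b) * inverse ?q)) (at x)"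
      by (rule derivative_eq_intros profile_inner_self_has_derivative refl)+ simp
    from partial_deriv_eq_frechet_derivative[OF this, of b] show ?thesis
      by (simp add: algebra_simps)
  qed
  then have "laplacian (\<lambda>y::real^2. pot (y \<bullet> y)) x =
      (\<Sum>b\<in>Basis. 2 * (b \<bullet> b) * inverse ?q - 4 * ?q' * inverse ?q ^ 2 * ((x \<bullet> b) * (x \<bullet> b)))"
    unfolding laplacian_def partial_deriv_pot_inner_self[abs_def] by simp
  also have "\<dots> = (\<Sum>b\<in>(Basis :: (real^2) set). 2 * inverse ?q) - 4 * ?q' * inverse ?q ^ 2 * (x \<bullet> x)"
    unfolding sum_subtractf sum_distrib_left[symmetric] euclidean_inner[of x x]
    by (simp add: inner_Basis)
  \<comment> \<open>The dimension enters here: \<open>Basis\<close> has two elements, so the sum is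
    \<open>4 * inverse ?q\<close>.\<close>
  also have "\<dots> = neg_charge (x \<bullet> x)"
    using profile_pos[of "x \<bullet> x"] by (simp add: neg_charge_def field_simps power2_eq_square)
  finally show ?thesis .
qed

section \<open>The stationary phase-space density, its charge and its field\<close>

definition steady_profile :: "(real^2) \<times> (real^2) \<Rightarrow> real" where
  "steady_profile = (\<lambda>(x, v). energy_dist ((v \<bullet> v) * (1/2) + pot (x \<bullet> x)))"

definition steady_state :: "(real^2) \<times> (real^2) \<times> real \<Rightarrow> real" where
  "steady_state = (\<lambda>(x, v, t). steady_profile (x, v))"

lemma smooth_steady_profile: "smooth steady_profile"
  unfolding steady_profile_def case_prod_unfold
  by (intro smooth_compose[OF smooth_energy_dist] smooth_add smooth_mult smooth_const
      smooth_compose[OF smooth_pot] smooth_norm_square bounded_linear_fst bounded_linear_snd)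

lemma smooth_steady_state: "smooth steady_state"
  unfolding steady_state_def steady_profile_def case_prod_unfold fst_conv snd_conv
  by (intro smooth_compose[OF smooth_energy_dist] smooth_add smooth_mult smooth_const
      smooth_compose[OF smooth_pot] smooth_norm_square bounded_linear_fst
      bounded_linear_compose[OF bounded_linear_fst bounded_linear_snd])

text \<open>Bound for the squared speed in the support: the total energy is at most
  \<open>pot 1\<close> and the potential at least \<open>pot 0\<close>, and kinetic energy is half
  the squared speed.\<close>

definition velocity_bound :: real where
  "velocity_bound = 2 * (pot 1 - pot 0)"

lemma steady_profile_support:
  assumes "steady_profile (x, v) \<noteq> 0"
  shows "x \<bullet> x \<le> 1" "v \<bullet> v \<le> velocity_bound"
proof -
  have e: "(v \<bullet> v) * (1/2) + pot (x \<bullet> x) \<le> pot 1"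
    using assms energy_dist_zero by (force simp: steady_profile_def not_less[symmetric])
  moreover have "0 \<le> v \<bullet> v" by simp
  ultimately have "pot (x \<bullet> x) \<le> pot 1" by linarith
  then show "x \<bullet> x \<le> 1"
    using pot_strict_mono by (simp add: strict_mono_less_eq)
  have "pot 0 \<le> pot (x \<bullet> x)"
    using pot_strict_mono by (simp add: strict_mono_less_eq)
  then show "v \<bullet> v \<le> velocity_bound"
    using e by (simp add: velocity_bound_def)
qed

lemma schwartz_steady_profile: "schwartz steady_profile"
proof (rule schwartz_if_compact_support[OF smooth_steady_profile])
  fix z :: "(real^2) \<times> (real^2)" assume z: "norm z > sqrt (1 + velocity_bound)"
  obtain x v where xv: "z = (x, v)" by (cases z)
  have "z \<bullet> z > 1 + velocity_bound"
    using z by (simp add: norm_eq_sqrt_inner)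
  then show "steady_profile z = 0"
    using steady_profile_support[of x v] unfolding xv by fastforce
qed

text \<open>In the variable \<open>s = |v|^2\<close> the integrand \<open>h\<close> has the explicit
  antiderivative \<open>F\<close>, because \<open>energy_dist\<close> was built as a derivative.
  \<open>F\<close> vanishes at high energy, so only its value at \<open>s = 0\<close>, which is the
  charge at \<open>x\<close>, remains.\<close>

lemma steady_profile_velocity_integral:
  "has_bochner_integral lborel (\<lambda>v. steady_profile (x, v)) (- neg_charge (x \<bullet> x))"
proof -
  define c where "c = pot (x \<bullet> x)"
  define h where "h s = energy_dist (s * (1/2) + c)" for s
  define F where "F s = neg_charge (pot_inv (s * (1/2) + c)) * (1 / pi)" for s
  have cont: "continuous_on UNIV h"
    unfolding h_def by (intro continuous_on_compose2[OF smooth_continuous[OF smooth_energy_dist]] continuous_intros) auto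
  then have [measurable]: "h \<in> borel_measurable borel"
    by (rule borel_measurable_continuous_onI)
  \<comment> \<open>The extra \<open>1\<close> puts the energy at \<open>b\<close> strictly above
    \<open>pot 1\<close>, so that \<open>h\<close> vanishes beyond \<open>b\<close> and
    \<open>F b = 0\<close>.\<close>
  define b where "b = max 0 (2 * (pot 1 - c) + 1)"
  have b: "0 \<le> b" "b * (1/2) + c > pot 1"
    by (auto simp: b_def max_def field_simps)
  have F': "(F has_real_derivative h s) (at s)" for s
    unfolding F_def h_def
    by (rule derivative_eq_intros DERIV_chain2[OF neg_charge_pot_inv_deriv] refl)+ simp
  have "has_bochner_integral lborel (\<lambda>s. h s * indicator {0..b} s) (F b - F 0)"
    using b F' cont by (intro has_bochner_integral_FTC_Icc_real) (auto simp: continuous_on_eq_continuous_at)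
  moreover have "h s * indicator {0..b} s = indicator {0..} s *\<^sub>R h s" for s
  proof (cases "s > b")
    case True
    then have "h s = 0"
      unfolding h_def using b by (intro energy_dist_zero) auto
    then show ?thesis by simp
  qed (auto split: split_indicator)
  moreover have "pot_inv (b * (1/2) + c) > 1"
    using b(2) pot_strict_mono by (metis pot_inverse(1) strict_mono_less)
  then have "F b - F 0 = - neg_charge (x \<bullet> x) * (1 / pi)"
    by (simp add: F_def neg_charge_gt_1 c_def)
  ultimately have I: "has_bochner_integral lborel (\<lambda>s. indicator {0..} s *\<^sub>R h s) (- neg_charge (x \<bullet> x) * (1 / pi))"
    by simp
  then have "integrable lborel (\<lambda>v::real^2. h (v \<bullet> v))"
    by (subst integrable_inner_self_iff) (auto simp: has_bochner_integral_iff)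
  moreover have "(\<integral>v. h (v \<bullet> v) \<partial>(lborel :: (real^2) measure)) = - neg_charge (x \<bullet> x)"
    using I by (subst integral_inner_self) (auto simp: has_bochner_integral_iff)
  ultimately show ?thesis
    by (simp add: has_bochner_integral_iff steady_profile_def h_def c_def)
qed

lemma charge_density_steady_state:
  "integrable lborel (\<lambda>w. steady_state (x, w, t))"
  "charge_density steady_state x t = - neg_charge (x \<bullet> x)"
  using steady_profile_velocity_integral[of x]
  by (auto simp: charge_density_def steady_state_def has_bochner_integral_iff)

lemma borel_measurable_steady_profile [measurable]:
  "steady_profile \<in> borel_measurable borel"
  by (intro borel_measurable_continuous_onI smooth_continuous smooth_steady_profile)

lemma borel_measurable_K [measurable]: "K \<in> borel_measurable borel"
  unfolding K_def[abs_def] by measurable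

lemma integrable_steady_profile_K:
  "integrable lborel (\<lambda>(y, \<xi>). steady_profile (y, \<xi>) *\<^sub>R K (x - y))"
proof -
  obtain C where C: "\<And>z. norm (steady_profile z) \<le> C"
    using schwartz_steady_profile unfolding schwartz_def
    by (metis empty_subsetI iter_partial.simps(1) list.set(1) mult_1 power_0)
  have "0 \<le> C" using C norm_ge_zero order_trans by blast
  \<comment> \<open>The majorant is a product: the singularity depends on position alone, and
    bounded velocity support makes the other factor integrable.\<close>
  define a where "a y = indicator (cball 0 1) y / norm (x - y)" for y :: "real^2"
  define b where "b \<xi> = C * indicator (cball 0 (sqrt velocity_bound)) \<xi>" for \<xi> :: "real^2"
  have [measurable]: "a \<in> borel_measurable borel" "b \<in> borel_measurable borel"
    unfolding a_def b_def
    by (intro borel_measurable_divide borel_measurable_times borel_measurable_indicator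
        borel_measurable_const borel_measurable_norm borel_measurable_diff; simp)+
  have a: "integrable lborel a"
    by (rule integrable_bounded_over_norm[of a 1 1 x]) (auto simp: a_def split: split_indicator)
  have b: "integrable lborel b"
    unfolding b_def by (intro integrable_mult_right integrable_real_indicator) (auto simp: emeasure_lborel_cball_finite[unfolded infinity_ennreal_def])
  have "integrable (lborel \<Otimes>\<^sub>M lborel) (\<lambda>(y, \<xi>). a y * b \<xi>)"
  proof (rule lborel_pair.Fubini_integrable)
    show "integrable lborel (\<lambda>y. \<integral>\<xi>. norm (case (y, \<xi>) of (y, \<xi>) \<Rightarrow> a y * b \<xi>) \<partial>lborel)"
      using a by (simp add: abs_mult)
    show "AE y in lborel. integrable lborel (\<lambda>\<xi>. case (y, \<xi>) of (y, \<xi>) \<Rightarrow> a y * b \<xi>)"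
      using b by simp
  qed measurable
  then have "integrable lborel (\<lambda>(y, \<xi>). a y * b \<xi>)"
    by (simp add: lborel_prod)
  then show ?thesis
  proof (rule Bochner_Integration.integrable_bound)
    show "AE z in lborel. norm (case z of (y, \<xi>) \<Rightarrow> steady_profile (y, \<xi>) *\<^sub>R K (x - y))
        \<le> norm (case z of (y, \<xi>) \<Rightarrow> a y * b \<xi>)"
    proof (rule AE_I2)
      fix z :: "(real^2) \<times> (real^2)"
      obtain y \<xi> where z: "z = (y, \<xi>)" by (cases z)
      show "norm (case z of (y, \<xi>) \<Rightarrow> steady_profile (y, \<xi>) *\<^sub>R K (x - y))
        \<le> norm (case z of (y, \<xi>) \<Rightarrow> a y * b \<xi>)"
      proof (cases "steady_profile (y, \<xi>) = 0")
        case False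
        have "norm (K w) \<le> 1 / norm w" for w
        proof -
          have "norm (K w) = (1 / (2 * pi)) * (1 / norm w)"
            by (simp add: K_def power2_eq_square)
          also have "\<dots> \<le> 1 * (1 / norm w)"
            using pi_ge_two by (intro mult_right_mono) (auto simp: field_simps)
          finally show ?thesis by simp
        qed
        moreover have "a y * b \<xi> = C * (1 / norm (x - y))"
          using steady_profile_support[OF False] by (simp add: a_def b_def norm_eq_sqrt_inner)
        ultimately show ?thesis
          unfolding z using C[of "(y, \<xi>)"] \<open>0 \<le> C\<close>
          by (simp add: mult_mono[of _ C _ "1 / norm (x - y)", simplified])
      qed (simp add: z)
    qed
    have "(\<lambda>z :: (real^2) \<times> (real^2). x - fst z) \<in> borel_measurable borel"
      by (intro borel_measurable_continuous_onI continuous_intros)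
    then have "(\<lambda>z. steady_profile z *\<^sub>R K (x - fst z)) \<in> borel_measurable borel"
      by (intro borel_measurable_scaleR borel_measurable_steady_profile measurable_compose[OF _ borel_measurable_K])
    then show "(\<lambda>(y, \<xi>). steady_profile (y, \<xi>) *\<^sub>R K (x - y)) \<in> borel_measurable lborel"
      by (simp add: case_prod_unfold)
  qed
qed

text \<open>Integrating out the velocities leaves the field of a planar radial charge. By the
  fundamental theorem of calculus the enclosed integral is \<open>- 4 * s / profile s\<close> at
  \<open>s = x \<bullet> x\<close>, and dividing by \<open>2 * s\<close> gives the claim.\<close>

lemma efield_steady_state:
  "efield steady_state x t = - ((2 * inverse (profile (x \<bullet> x))) *\<^sub>R x)"
proof -
  \<comment> \<open>Cutting off negative \<open>s\<close>, which squared norms never attain,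
    supplies the bound on the whole line that \<open>radial_charge_field\<close> asks for.\<close>
  define \<rho> where "\<rho> s = - neg_charge s * indicator {0..} s" for s
  have cont: "continuous_on A neg_charge" for A
    using smooth_continuous[OF smooth_neg_charge] continuous_on_subset by blast
  have [measurable]: "neg_charge \<in> borel_measurable borel"
    by (intro borel_measurable_continuous_onI cont)
  have "bounded (neg_charge ` {0..1})"
    by (intro compact_imp_bounded compact_continuous_image cont) auto
  then obtain B where B: "\<And>s. s \<in> {0..1} \<Longrightarrow> \<bar>neg_charge s\<bar> \<le> B"
    by (metis bounded_iff imageI real_norm_def)
  have "0 \<le> B" using B[of 0] by simp
  then have bound: "\<bar>\<rho> s\<bar> \<le> B" for s
    using B[of s] neg_charge_gt_1[of s] by (cases "s \<le> 1") (auto simp: \<rho>_def split: split_indicator)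
  have supp: "\<rho> s = 0" if "s > 1" for s
    using that by (simp add: \<rho>_def neg_charge_gt_1)
  have [measurable]: "\<rho> \<in> borel_measurable borel"
    unfolding \<rho>_def by measurable
  have "efield steady_state x t = (\<integral>z. (case z of (y, \<xi>) \<Rightarrow> steady_profile (y, \<xi>) *\<^sub>R K (x - y)) \<partial>(lborel \<Otimes>\<^sub>M lborel))"
    by (simp add: efield_def steady_state_def lborel_prod)
  also have "\<dots> = (\<integral>y. \<integral>\<xi>. steady_profile (y, \<xi>) *\<^sub>R K (x - y) \<partial>lborel \<partial>lborel)"
    using lborel_pair.integral_fst'[of "\<lambda>(y, \<xi>). steady_profile (y, \<xi>) *\<^sub>R K (x - y)"]
      integrable_steady_profile_K[of x] by (simp add: lborel_prod)
  also have "\<dots> = (\<integral>y. \<rho> (y \<bullet> y) *\<^sub>R K (x - y) \<partial>lborel)"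
    using steady_profile_velocity_integral
    by (intro Bochner_Integration.integral_cong refl) (auto simp: has_bochner_integral_iff \<rho>_def)
  also have "\<dots> = ((\<integral>s. indicator {0..<x \<bullet> x} s * \<rho> s \<partial>lborel) / (2 * (x \<bullet> x))) *\<^sub>R x"
    using radial_charge_field[of \<rho> B 1 x] bound supp by (simp add: has_bochner_integral_iff)
  also have "(\<integral>s. indicator {0..<x \<bullet> x} s * \<rho> s \<partial>lborel) =
      - (\<integral>s. neg_charge s * indicator {0..x \<bullet> x} s \<partial>lborel)"
    unfolding integral_minus[symmetric]
    by (intro integral_cong_AE)
      (use AE_lborel_singleton[of "x \<bullet> x"] in \<open>auto elim!: eventually_mono simp: \<rho>_def indicator_def\<close>)
  also have "(\<integral>s. neg_charge s * indicator {0..x \<bullet> x} s \<partial>lborel) =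
      4 * (x \<bullet> x) * inverse (profile (x \<bullet> x)) - 4 * 0 * inverse (profile 0)"
    by (intro has_bochner_integral_integral_eq has_bochner_integral_FTC_Icc_real enclosed_charge_deriv)
      (use cont[of UNIV] in \<open>auto simp: continuous_on_eq_continuous_at\<close>)
  finally show ?thesis
    by (cases "x = 0") (simp_all add: field_simps)
qed

lemma vlasov_poisson_steady_state: "vlasov_poisson_solution steady_profile steady_state"
  unfolding vlasov_poisson_solution_def
proof (intro conjI allI)
  show "smooth steady_state" by (rule smooth_steady_state)
  fix x v :: "real^2" and t :: real
  show "steady_state (x, v, 0) = steady_profile (x, v)"
    by (simp add: steady_state_def)
  show "integrable lborel (\<lambda>w. steady_state (x, w, t))"
    by (rule charge_density_steady_state)
  show "integrable lborel (\<lambda>(y, \<xi>). steady_state (y, \<xi>, t) *\<^sub>R K (x - y))"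
    using integrable_steady_profile_K by (simp add: steady_state_def)
  let ?\<phi> = "\<lambda>z :: (real^2) \<times> real. pot (fst z \<bullet> fst z)"
  have "smooth ?\<phi>"
    by (intro smooth_compose[OF smooth_pot] smooth_norm_square bounded_linear_fst)
  moreover have "efield steady_state x t = - grad (\<lambda>y. ?\<phi> (y, t)) x" for x t
    by (simp add: efield_steady_state grad_radial[OF pot_deriv])
  moreover have "- laplacian (\<lambda>y. ?\<phi> (y, t)) x = charge_density steady_state x t" for x t
    by (simp add: laplacian_pot_inner_self charge_density_steady_state)
  ultimately show "\<exists>\<phi>. smooth \<phi> \<and>
      (\<forall>x t. efield steady_state x t = - grad (\<lambda>y. \<phi> (y, t)) x) \<and>
      (\<forall>x t. - laplacian (\<lambda>y. \<phi> (y, t)) x = charge_density steady_state x t)"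
    by blast
  let ?d = "partial_deriv 1 energy_dist ((v \<bullet> v) * (1/2) + pot (x \<bullet> x))"
  note D = DERIV_chain2[OF smooth_has_real_derivative[OF smooth_energy_dist]]
  have "((\<lambda>s. energy_dist ((v \<bullet> v) * (1/2) + pot s)) has_real_derivative
      ?d * inverse (profile (x \<bullet> x))) (at (x \<bullet> x))"
    by (rule D) (auto intro!: derivative_eq_intros pot_deriv)
  from grad_radial[OF this]
  have x: "grad (\<lambda>y. steady_state (y, v, t)) x = (2 * (?d * inverse (profile (x \<bullet> x)))) *\<^sub>R x"
    by (simp add: steady_state_def steady_profile_def)
  have "((\<lambda>s. energy_dist (s * (1/2) + pot (x \<bullet> x))) has_real_derivative ?d * (1/2)) (at (v \<bullet> v))"
    by (rule D) (auto intro!: derivative_eq_intros)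
  from grad_radial[OF this]
  have v: "grad (\<lambda>w. steady_state (x, w, t)) v = ?d *\<^sub>R v"
    by (simp add: steady_state_def steady_profile_def)
  have "deriv (\<lambda>s. steady_state (x, v, s)) t = 0"
    by (simp add: steady_state_def)
  \<comment> \<open>Energy conservation: both transport terms are the same multiple of
    \<open>x \<bullet> v\<close>, with opposite signs.\<close>
  then show "deriv (\<lambda>s. steady_state (x, v, s)) t + v \<bullet> grad (\<lambda>y. steady_state (y, v, t)) x +
      efield steady_state x t \<bullet> grad (\<lambda>w. steady_state (x, w, t)) v = 0"
    unfolding x v efield_steady_state by (simp add: inner_commute)
qed

lemma efield_steady_state_lipschitz:
  "\<exists>M\<ge>0. \<forall>x y. norm (efield steady_state x t - efield steady_state y t) \<le> M * norm (x - y)"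
proof -
  define e where "e x = (2 * inverse (profile (x \<bullet> x))) *\<^sub>R x" for x :: "real^2"
  \<comment> \<open>By Cauchy-Schwarz, \<open>S (x \<bullet> x)\<close> bounds the operator norm of
    the derivative of \<open>e\<close> at \<open>x\<close>. Compactness controls it on the disc;
    outside, it equals \<open>2/s + 4/s = 6/s\<close>, whence the constant \<open>6\<close>.\<close>
  define S where "S s = 2 * inverse (profile s) + 4 * s * \<bar>profile' s\<bar> * inverse (profile s) ^ 2" for s
  have "continuous_on {0..1} S"
    unfolding S_def using profile_pos
    by (intro continuous_intros ballI) (auto simp: less_imp_neq[THEN not_sym])
  then have "bounded (S ` {0..1})"
    by (intro compact_imp_bounded compact_continuous_image) auto
  then obtain M0 where M0: "\<And>s. s \<in> {0..1} \<Longrightarrow> \<bar>S s\<bar> \<le> M0"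
    by (metis bounded_iff imageI real_norm_def)
  define M where "M = max M0 6"
  have SM: "S s \<le> M" if "0 \<le> s" for s
  proof (cases "s \<le> 1")
    case True
    then show ?thesis using M0[of s] that by (auto simp: M_def abs_le_iff)
  next
    case False
    then have "S s = 6 * inverse s"
      by (simp add: S_def profile_ge_1 profile'_gt_1 power2_eq_square)
    also have "\<dots> \<le> 6"
      using False by (simp add: field_simps)
    finally show ?thesis by (simp add: M_def)
  qed
  have "norm (e x - e y) \<le> M * norm (x - y)" for x y
  proof (rule differentiable_bound[of UNIV])
    fix x :: "real^2"
    let ?q = "profile (x \<bullet> x)" and ?q' = "profile' (x \<bullet> x)"
    let ?D = "\<lambda>v. (2 * inverse ?q) *\<^sub>R v + (2 * - (2 * ?q' * (x \<bullet> v) * inverse ?q ^ 2)) *\<^sub>R x"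
    show "(e has_derivative ?D) (at x within UNIV)"
      unfolding e_def
      by (rule has_derivative_scaleR has_derivative_mult_right profile_inner_self_has_derivative has_derivative_ident)+
    show "onorm ?D \<le> M"
    proof (rule onorm_le)
      fix v :: "real^2"
      have "norm (?D v) \<le> norm ((2 * inverse ?q) *\<^sub>R v) + norm ((2 * - (2 * ?q' * (x \<bullet> v) * inverse ?q ^ 2)) *\<^sub>R x)"
        by (rule norm_triangle_ineq)
      also have "\<dots> = 2 * inverse ?q * norm v + 4 * \<bar>?q'\<bar> * inverse ?q ^ 2 * (\<bar>x \<bullet> v\<bar> * norm x)"
        using profile_pos[of "x \<bullet> x"] by (simp add: abs_mult)
      also have "\<bar>x \<bullet> v\<bar> * norm x \<le> (norm x * norm v) * norm x"
        by (intro mult_right_mono Cauchy_Schwarz_ineq2) auto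
      also have "2 * inverse ?q * norm v + 4 * \<bar>?q'\<bar> * inverse ?q ^ 2 * ((norm x * norm v) * norm x) = S (x \<bullet> x) * norm v"
        by (simp add: S_def dot_square_norm power2_eq_square algebra_simps)
      also have "\<dots> \<le> M * norm v"
        by (intro mult_right_mono SM) auto
      finally show "norm (?D v) \<le> M * norm v"
        by (simp add: mult_left_mono)
    qed
  qed auto
  then show ?thesis
    by (intro exI[of _ M]) (auto simp: efield_steady_state e_def M_def norm_minus_commute)
qed

lemma trajectory_map_steady_state: "\<exists>X V. trajectory_map (efield steady_state) X V"
proof -
  define E\<^sub>0 where "E\<^sub>0 x = efield steady_state x 0" for x
  have E: "efield steady_state x t = E\<^sub>0 x" for x t
    by (simp add: E\<^sub>0_def efield_steady_state)
  obtain M where M: "0 \<le> M" "\<And>x y. norm (E\<^sub>0 x - E\<^sub>0 y) \<le> M * norm (x - y)"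
    using efield_steady_state_lipschitz unfolding E\<^sub>0_def by blast
  define A where "A p = (snd p, E\<^sub>0 (fst p))" for p :: "(real^2) \<times> (real^2)"
  have lip: "norm (A p - A p') \<le> (1 + M) * norm (p - p')" for p p'
  proof -
    have "norm (A p - A p') \<le> norm (snd (p - p')) + norm (E\<^sub>0 (fst p) - E\<^sub>0 (fst p'))"
      unfolding A_def using norm_Pair_le[of "snd p - snd p'" "E\<^sub>0 (fst p) - E\<^sub>0 (fst p')"] by simp
    also have "\<dots> \<le> norm (p - p') + M * norm (fst (p - p'))"
      using M(2)[of "fst p" "fst p'"] norm_snd_le[of "snd (p - p')" "fst (p - p')"]
      by (simp add: minus_prod_def)
    also have "\<dots> \<le> norm (p - p') + M * norm (p - p')"
      using M(1) norm_fst_le[of "fst (p - p')" "snd (p - p')"] by (intro add_left_mono mult_left_mono) (simp_all add: minus_prod_def)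
    finally show ?thesis by (simp add: algebra_simps)
  qed
  have "\<exists>Y. \<forall>\<zeta>. Y \<zeta> 0 = \<zeta> \<and> (\<forall>t. (Y \<zeta> has_vector_derivative A (Y \<zeta> t)) (at t))"
    using M by (intro choice allI lipschitz_ode_global[OF lip]) auto
  then obtain Y where Y: "\<And>\<zeta>. Y \<zeta> 0 = \<zeta>" "\<And>\<zeta> t. (Y \<zeta> has_vector_derivative A (Y \<zeta> t)) (at t)"
    by blast
  have "trajectory_map (efield steady_state) (\<lambda>\<zeta> t. fst (Y \<zeta> t)) (\<lambda>\<zeta> t. snd (Y \<zeta> t))"
    unfolding trajectory_map_def E
    using bounded_linear.has_vector_derivative[OF bounded_linear_fst Y(2)]
      bounded_linear.has_vector_derivative[OF bounded_linear_snd Y(2)] Y(1)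
    by (auto simp: A_def)
  then show ?thesis by blast
qed

section \<open>Non-analytic trajectories\<close>

text \<open>Convergence at the nonnegative reals below \<open>r\<close> already forces convergence
  on the whole complex disc. Complexifying makes the finite order of zeros of holomorphic functions
  available.\<close>

lemma real_power_series_holomorphic:
  fixes c :: "nat \<Rightarrow> real"
  assumes "\<And>t. 0 \<le> t \<Longrightarrow> t < r \<Longrightarrow> (\<lambda>n. t ^ n * c n) sums g t"
  shows "\<exists>G. G holomorphic_on ball 0 r \<and> (\<forall>t. 0 \<le> t \<longrightarrow> t < r \<longrightarrow> G (of_real t) = complex_of_real (g t))"
proof -
  define G where "G z = (\<Sum>n. of_real (c n) * z ^ n)" for z :: complex
  have "(\<lambda>n. of_real (c n) * (w - 0) ^ n) sums G w" if "w \<in> ball 0 r" for w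
  proof -
    \<comment> \<open>A real point of convergence strictly farther out than
      \<open>w\<close>.\<close>
    define t where "t = (norm w + r) / 2"
    have t: "norm w < t" "t < r"
      using that by (auto simp: t_def)
    then have "(\<lambda>n. complex_of_real (t ^ n * c n)) sums of_real (g t)"
      using assms[of t] norm_ge_zero[of w] by (intro sums_of_real) linarith
    then have "summable (\<lambda>n. of_real (c n) * complex_of_real t ^ n)"
      by (auto simp: sums_iff mult.commute)
    moreover have "norm w < norm (complex_of_real t)"
      using t norm_ge_zero[of w] by simp
    ultimately have "summable (\<lambda>n. of_real (c n) * w ^ n)"
      by (rule powser_inside)
    then show ?thesis by (simp add: G_def summable_sums)
  qed
  then have "G holomorphic_on ball 0 r"
    by (rule power_series_holomorphic)
  moreover have "G (of_real t) = complex_of_real (g t)" if "0 \<le> t" "t < r" for t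
  proof -
    have "(\<lambda>n. of_real (c n) * complex_of_real t ^ n) sums of_real (g t)"
      using sums_of_real[OF assms[OF that], where 'a = complex] by (simp add: mult.commute)
    then show ?thesis by (simp add: G_def sums_iff)
  qed
  ultimately show ?thesis by blast
qed

text \<open>Otherwise \<open>W\<close> would factor near \<open>0\<close> as \<open>z^n\<close>
  times a function without zeros, whose value at \<open>0\<close> the flatness condition with this
  \<open>n\<close> forces to be zero. Approach along the positive reals is enough.\<close>

lemma holomorphic_flat_eq_0:
  assumes holo: "W holomorphic_on ball 0 r" and "0 < r" "z \<in> ball 0 r"
    and flat: "\<And>n. ((\<lambda>t. W (of_real t) / of_real t ^ n) \<longlongrightarrow> 0) (at_right (0::real))"
  shows "W z = (0::complex)"
proof -
  have right: "filterlim complex_of_real (nhds 0) (at_right 0)"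
    using tendsto_of_real[OF tendsto_ident_at, of 0 "{0<..}", where 'a = complex] by simp
  have lim: "((\<lambda>t. G (complex_of_real t)) \<longlongrightarrow> G 0) (at_right 0)"
    if "G holomorphic_on ball 0 e" "0 < e" for G e
  proof -
    have "isCont G 0"
      using that by (intro continuous_on_interior[OF holomorphic_on_imp_continuous_on]) auto
    then show ?thesis
      using right isCont_tendsto_compose by blast
  qed
  have W0: "W 0 = 0"
    using tendsto_unique[OF _ lim[OF holo \<open>0 < r\<close>]] flat[of 0] by simp
  show ?thesis
  proof (cases "W constant_on ball 0 r")
    case True
    then show ?thesis
      using W0 \<open>0 < r\<close> \<open>z \<in> ball 0 r\<close> unfolding constant_on_def by force
  next
    case False
    then obtain G e n where G: "0 < e" "G holomorphic_on ball 0 e"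
        "\<And>w. w \<in> ball 0 e \<Longrightarrow> W w = (w - 0) ^ n * G w"
        "\<And>w. w \<in> ball 0 e \<Longrightarrow> G w \<noteq> 0"
      using holomorphic_factor_zero_nonconstant[OF holo, of 0] W0 \<open>0 < r\<close>
      by (metis centre_in_ball connected_ball open_ball)
    have "\<forall>\<^sub>F t in at_right 0. t \<in> {0<..<e}"
      using G(1) by (rule eventually_at_right_real)
    then have "\<forall>\<^sub>F t in at_right 0. W (of_real t) / of_real t ^ n = G (of_real t)"
      by eventually_elim (use G(3) in auto)
    then have "((\<lambda>t. G (complex_of_real t)) \<longlongrightarrow> 0) (at_right 0)"
      using flat[of n] by (rule Lim_transform_eventually[rotated])
    then have "G 0 = 0"
      using tendsto_unique[OF _ lim[OF G(2,1)]] by simp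
    then show ?thesis using G(1) G(4)[of 0] by simp
  qed
qed

text \<open>Any power of \<open>u\<close> can be split off, and the cofactor still tends to zero at
  \<open>0\<close>; this expresses vanishing to infinite order.\<close>

lemma flat_power_shift: "0 < u \<Longrightarrow> flat 1 u = u ^ n * flat (monom 1 n) u"
  by (simp add: flat_def poly_monom power_inverse)

text \<open>The work rate \<open>X \<bullet> V'\<close> equals \<open>- 2 s / profile s\<close> with \<open>s = X \<bullet> X\<close>. It is
  analytic together with the trajectory, but along a trajectory entering the unit disc it
  differs from its value \<open>- 2\<close> outside by a nonzero function that is flat at the time of entry.\<close>

lemma entering_trajectory_not_analytic:
  fixes x v :: "real \<Rightarrow> real^2"
  assumes x': "\<And>t. (x has_vector_derivative v t) (at t)"
    and v': "\<And>t. (v has_vector_derivative - ((2 * inverse (profile (x t \<bullet> x t))) *\<^sub>R x t)) (at t)"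
    and init: "x 0 \<bullet> x 0 = 1" "x 0 \<bullet> v 0 < 0"
  shows "\<not> analytic_within (\<lambda>t. (x t, v t)) 0 {0..}"
proof
  assume "analytic_within (\<lambda>t. (x t, v t)) 0 {0..}"
  then obtain r a where r: "0 < r" and
    ser: "\<And>t. 0 \<le> t \<Longrightarrow> t < r \<Longrightarrow> (\<lambda>n. t ^ n *\<^sub>R a n) sums (x t, v t)"
    unfolding analytic_within_def by force
  have sx: "(\<lambda>n. t ^ n * (fst (a n) $ i)) sums (x t $ i)" if "0 \<le> t" "t < r" for t i
    using bounded_linear.sums[OF bounded_linear_compose[OF bounded_linear_vec_nth bounded_linear_fst] ser[OF that], of i]
    by simp
  have sv: "(\<lambda>n. t ^ n * (snd (a n) $ i)) sums (v t $ i)" if "0 \<le> t" "t < r" for t i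
    using bounded_linear.sums[OF bounded_linear_compose[OF bounded_linear_vec_nth bounded_linear_snd] ser[OF that], of i]
    by simp
  have "\<forall>i. \<exists>G. G holomorphic_on ball 0 r \<and> (\<forall>t. 0 \<le> t \<longrightarrow> t < r \<longrightarrow> G (of_real t) = complex_of_real (x t $ i))"
    using real_power_series_holomorphic[OF sx] by blast
  then obtain P where P: "\<And>i. P i holomorphic_on ball 0 r"
    "\<And>i t. 0 \<le> t \<Longrightarrow> t < r \<Longrightarrow> P i (of_real t) = complex_of_real (x t $ i)"
    by metis
  have "\<forall>i. \<exists>G. G holomorphic_on ball 0 r \<and> (\<forall>t. 0 \<le> t \<longrightarrow> t < r \<longrightarrow> G (of_real t) = complex_of_real (v t $ i))"
    using real_power_series_holomorphic[OF sv] by blast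
  then obtain Q where Q: "\<And>i. Q i holomorphic_on ball 0 r"
    "\<And>i t. 0 \<le> t \<Longrightarrow> t < r \<Longrightarrow> Q i (of_real t) = complex_of_real (v t $ i)"
    by metis
  \<comment> \<open>The complexified work rate, shifted by its constant value outside the
    disc.\<close>
  define W where "W z = (\<Sum>i\<in>UNIV. P i z * deriv (Q i) z) + 2" for z
  have W_holo: "W holomorphic_on ball 0 r"
    unfolding W_def by (intro holomorphic_intros P Q holomorphic_deriv) auto
  define s where "s t = x t \<bullet> x t" for t
  \<comment> \<open>Only for \<open>0 < t\<close>: the series represents \<open>v\<close> on forward
    times alone, and comparing derivatives requires agreement on an open interval around
    \<open>t\<close>.\<close>
  have deriv_Q: "deriv (Q i) (of_real t) = of_real (- (2 * inverse (profile (s t)) * x t $ i))"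
    if "0 < t" "t < r" for t i
  proof -
    have "(Q i has_field_derivative deriv (Q i) (of_real t)) (at (of_real t))"
      using that Q(1) by (intro holomorphic_derivI[of _ "ball 0 r"]) auto
    then have "((\<lambda>t. Q i (of_real t)) has_vector_derivative deriv (Q i) (of_real t)) (at t)"
      using field_vector_diff_chain_at[OF has_vector_derivative_of_real[OF DERIV_ident], where g = "Q i"]
      by (simp add: o_def)
    then have "((\<lambda>t. complex_of_real (v t $ i)) has_vector_derivative deriv (Q i) (of_real t)) (at t)"
      by (rule has_vector_derivative_transform_within_open[of _ _ _ "{0<..<r}"]) (use that Q(2) in auto)
    moreover have "((\<lambda>t. complex_of_real (v t $ i)) has_vector_derivative
        of_real ((- ((2 * inverse (profile (s t))) *\<^sub>R x t)) $ i)) (at t)"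
      unfolding s_def
      by (intro has_vector_derivative_of_real has_real_derivative_iff_has_vector_derivative[THEN iffD2]
          bounded_linear.has_vector_derivative[OF bounded_linear_vec_nth] v')
    ultimately show ?thesis
      using vector_derivative_unique_at by fastforce
  qed
  have W_eq: "W (of_real t) = of_real (2 * (1 - s t) * flat 1 (1 - s t) / profile (s t))"
    if "0 < t" "t < r" for t
  proof -
    have "W (of_real t) = of_real (\<Sum>i\<in>UNIV. - (2 * inverse (profile (s t))) * (x t $ i * x t $ i)) + 2"
      unfolding W_def using that
      by (simp add: P(2) deriv_Q mult_ac sum_negf)
    also have "(\<Sum>i\<in>UNIV. - (2 * inverse (profile (s t))) * (x t $ i * x t $ i)) = - (2 * inverse (profile (s t))) * s t"
      unfolding s_def inner_vec_def by (simp only: sum_distrib_left inner_real_def)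
    also have "of_real (- (2 * inverse (profile (s t))) * s t) + (2 :: complex) =
        of_real (- (2 * inverse (profile (s t))) * s t + 2)"
      by simp
    also have "- (2 * inverse (profile (s t))) * s t + 2 = 2 * (profile (s t) - s t) / profile (s t)"
      using profile_pos[of "s t"] by (simp add: field_simps)
    also have "\<dots> = 2 * (1 - s t) * flat 1 (1 - s t) / profile (s t)"
      by (simp add: profile_def[of "s t"])
    finally show ?thesis .
  qed
  \<comment> \<open>Minus the derivative of \<open>s\<close> at time \<open>0\<close>. It is
    positive for inward motion, so \<open>1 - s t\<close> behaves like \<open>k * t\<close> and
    powers of \<open>t\<close> can be traded for powers of \<open>1 - s t\<close>.\<close>
  define k where "k = - 2 * (x 0 \<bullet> v 0)"
  have k: "0 < k" using init by (simp add: k_def)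
  have s0: "s 0 = 1" by (simp add: s_def init)
  have "(s has_derivative (\<lambda>h. x 0 \<bullet> (h *\<^sub>R v 0) + (h *\<^sub>R v 0) \<bullet> x 0)) (at 0)"
    unfolding s_def using x'[of 0, unfolded has_vector_derivative_def] by (intro has_derivative_inner)
  then have "(s has_real_derivative - k) (at 0)"
    unfolding has_field_derivative_def k_def
    by (rule has_derivative_eq_rhs) (auto simp: inner_commute)
  then have s': "((\<lambda>t. (s t - s 0) / (t - 0)) \<longlongrightarrow> - k) (at 0)"
    and s_cont: "isCont s 0"
    by (auto simp: has_field_derivative_iff intro: DERIV_isCont)
  have "((\<lambda>t. - ((s t - s 0) / (t - 0))) \<longlongrightarrow> - (- k)) (at_right 0)"
    by (intro tendsto_minus tendsto_mono[OF _ s'] at_le) auto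
  then have ratio: "((\<lambda>t. (1 - s t) / t) \<longlongrightarrow> k) (at_right 0)"
    by (simp add: s0 minus_divide_left)
  have s_lim: "(s \<longlongrightarrow> 1) (at_right 0)"
    using s_cont s0 by (metis isCont_def filterlim_at_split)
  have pos: "\<forall>\<^sub>F t in at_right 0. 0 < 1 - s t"
  proof -
    have "\<forall>\<^sub>F t in at_right 0. 0 < (1 - s t) / t"
      using order_tendstoD(1)[OF ratio k] .
    moreover have "\<forall>\<^sub>F t::real in at_right 0. 0 < t"
      by (simp add: eventually_at_right_less)
    ultimately show ?thesis
      by eventually_elim (simp add: zero_less_divide_iff)
  qed
  have small: "\<forall>\<^sub>F t in at_right 0. 0 < t \<and> t < r"
    using eventually_at_right_real[OF r] by simp
  have gap: "((\<lambda>t. 1 - s t) \<longlongrightarrow> 0) (at_right 0)"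
    by (rule tendsto_eq_intros s_lim refl)+ simp
  then have gap_at: "filterlim (\<lambda>t. 1 - s t) (at 0) (at_right 0)"
    using pos by (auto simp: filterlim_at elim: eventually_mono)
  have profile_lim: "((\<lambda>t. profile (s t)) \<longlongrightarrow> profile 1) (at_right 0)"
    using smooth_continuous[OF smooth_profile] s_lim
    by (intro isCont_tendsto_compose[of 1 profile]) (auto simp: continuous_on_eq_continuous_at)
  have W_flat: "((\<lambda>t. W (of_real t) / of_real t ^ n) \<longlongrightarrow> 0) (at_right 0)" for n
  proof -
    have "((\<lambda>t. 2 * (1 - s t) * (((1 - s t) / t) ^ n * flat (monom 1 n) (1 - s t)) / profile (s t)) \<longlongrightarrow>
        2 * 0 * (k ^ n * 0) / profile 1) (at_right 0)"
      using profile_pos[of 1]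
      by (intro tendsto_intros gap ratio profile_lim filterlim_compose[OF flat_tendsto_0 gap_at]) auto
    then have "((\<lambda>t. complex_of_real (2 * (1 - s t) * (((1 - s t) / t) ^ n * flat (monom 1 n) (1 - s t)) / profile (s t))) \<longlongrightarrow> of_real 0) (at_right 0)"
      by (intro tendsto_of_real) simp
    then show ?thesis
      unfolding of_real_0
    proof (rule Lim_transform_eventually)
      show "\<forall>\<^sub>F t in at_right 0. complex_of_real (2 * (1 - s t) * (((1 - s t) / t) ^ n * flat (monom 1 n) (1 - s t)) / profile (s t))
          = W (of_real t) / of_real t ^ n"
        using pos small
      proof eventually_elim
        case (elim t)
        then have "2 * (1 - s t) * flat 1 (1 - s t) / profile (s t) / t ^ n =
            2 * (1 - s t) * (((1 - s t) / t) ^ n * flat (monom 1 n) (1 - s t)) / profile (s t)"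
          using flat_power_shift[of "1 - s t" n] by (simp add: power_divide)
        then show ?case
          using W_eq[of t] elim by (metis of_real_divide of_real_power)
      qed
    qed
  qed
  have W_zero: "W (of_real t) = 0" if "0 < t" "t < r" for t
    using that by (intro holomorphic_flat_eq_0[OF W_holo r _ W_flat]) auto
  \<comment> \<open>Just after entry \<open>1 - s t > 0\<close>, so the flat term is strictly
    positive although \<open>W\<close> vanishes identically.\<close>
  have "\<forall>\<^sub>F t in at_right (0::real). False"
    using pos small
  proof eventually_elim
    case (elim t)
    then have "2 * (1 - s t) * flat 1 (1 - s t) / profile (s t) = 0"
      using W_zero[of t] W_eq[of t] by (metis of_real_eq_0_iff)
    then show False
      using elim profile_pos[of "s t"] by (simp add: flat_def)
  qed
  then show False by simp
qed

theorem theorem6p14: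
  shows "\<exists>(f0 :: (real^2) \<times> (real^2) \<Rightarrow> real) (f :: (real^2) \<times> (real^2) \<times> real \<Rightarrow> real).
    schwartz f0 \<and> vlasov_poisson_solution f0 f \<and>
    (\<exists>X V. trajectory_map (efield f) X V \<and>
       (\<exists>\<zeta>\<^sub>0. \<not> analytic_within (\<lambda>t. (X \<zeta>\<^sub>0 t, V \<zeta>\<^sub>0 t)) 0 {0..}))"
proof -
  obtain X V where XV: "trajectory_map (efield steady_state) X V"
    using trajectory_map_steady_state by blast
  \<comment> \<open>On the unit circle, moving straight inward: \<open>x \<bullet> x = 1\<close> and
    \<open>x \<bullet> v = - 1\<close>.\<close>
  define \<zeta> :: "(real^2) \<times> (real^2)" where "\<zeta> = (axis 1 1, - axis 1 1)"
  have "(X \<zeta> 0, V \<zeta> 0) = \<zeta>"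
    and "\<And>t. (X \<zeta> has_vector_derivative V \<zeta> t) (at t)"
    and "\<And>t. (V \<zeta> has_vector_derivative - ((2 * inverse (profile (X \<zeta> t \<bullet> X \<zeta> t))) *\<^sub>R X \<zeta> t)) (at t)"
    using XV unfolding trajectory_map_def efield_steady_state by blast+
  then have "\<not> analytic_within (\<lambda>t. (X \<zeta> t, V \<zeta> t)) 0 {0..}"
    by (intro entering_trajectory_not_analytic) (auto simp: \<zeta>_def inner_axis_axis)
  then show ?thesis
    using schwartz_steady_profile vlasov_poisson_steady_state XV by blast
qed

end
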